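(* Let $n\ge 2$ be an integer and run $\mathit{CographGeneration}(n)$. Then: (a) the output sequence of cotrees $T_1^0,T_1^1,T_2^0,T_2^1,\dots$ contains (a representative of the isomorphism class of) every cotree with $n$ leaves; (b) the associated sequence of cographs $G_1^0,G_1^1,G_2^0,G_2^1,\dots$ contains, up to isomorphism, every cograph with $n$ vertices, and no two graphs in this sequence are isomorphic; (c) the delay of the algorithm (the time elapsed between two consecutive outputs) is $O(n)$; (d) the time spent by the algorithm to output the first element is $O(n)$.
   Context: A cograph is a $P_4$-free graph. A cotree of a cograph $G$ is a rooted tree whose leaves are the vertices of $G$, whose internal nodes each have at least two children and are labeled $0$ or $1$, with labels alternating along every root-to-leaf path, such that two vertices are adjacent iff their lowest common ancestor is labeled $1$. Every cograph has a cotree, unique up to isomorphism, and every such labeled tree is the cotree of a cograph. For an unlabeled tree $T$ with at least two leaves in which every internal node has at least two children, $T^0$ (resp. $T^1$) denotes the cotree obtained by labeling the root $0$ (resp. $1$) and labeling the other internal nodes so that labels alternate; $G^0$, $G^1$ denote the corresponding cographs. Let $\mathbb{T}$ be the set of finite rooted trees in which every internal node has at least two children; $T(v)$ is the subtree rooted at $v$, $l(v)$ its number of leaves, $\mathbb{T}_n=\{T\in\mathbb{T}:l(\mathrm{root}(T))=n\}$. For $p\ge2$, $\mathrm{Part}(p)$ is the set of non-decreasing sequences $(a_1,\dots,a_k)$ of positive integers with $k\ge2$ and sum $p$, ordered lexicographically (for distinct $a,b$, compare at the least index $j\le\min\{k,m\}$ with $a_j\ne b_j$); its maximum is $(\lfloor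 p/2\rfloor,\lceil p/2\rceil)$. Node comparison: by induction on the number of leaves, for nodes $v,w$: (1) if $l(v)<l(w)$ then $v<w$ (symmetrically); (2) if $l(v)=l(w)=1$ then $v\sim w$; (3) if $l(v)=l(w)\ge2$, list the children $v_1,\dots,v_k$ of $v$ and $w_1,\dots,w_m$ of $w$, each non-decreasing for this comparison; $(l(v_1),\dots,l(v_k))$ and $(l(w_1),\dots,l(w_m))$ are the induced partitions; (3.1) if the partition induced by $v$ is lexicographically smaller (resp. larger) then $v<w$ (resp. $w<v$); (3.2) if equal, then $v\sim w$ if $v_i\sim w_i$ for all $i$, and otherwise, with $j$ least such that $v_j\not\sim w_j$, $v<w$ iff $v_j<w_j$. Write $v\le w$ for $v<w$ or $v\sim w$. An ordered tree is a tree in $\mathbb{T}$ with, for every internal node, an arrangement $v_1\le\dots\le v_k$ of its children. A node is exhausted if it is a leaf or its induced partition is the maximum of $\mathrm{Part}(l(v))$. The inverted post-order traversal traverses, for the root with children $v_1,\dots,v_k$ in their arrangement, $T(v_k),\dots,T(v_1)$ recursively and then visits the root; the pivot is the first visited non-exhausted node, if any. Procedure $\mathit{NextTree}$ on an ordered $T\in\mathbb{T}_n$: (i) find the pivot $v$; if none, return null. (ii) Let $b=(b_1,\dots,b_m)$ be the element of $\mathrm{Part}(l(v))$ immediately next to the partition induced by $v$ (computed by: if $a_1\ne\lfloor p/2\rfloor$ where $a=(a_1,\dots,a_k)$ is the induced partition and $p=l(v)$, then if $a_k-a_{k-1}\le1$ take $(a_1,\dots,a_{k-2},a_{k-1}+a_k)$,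 else with $c=a_{k-1}+1$, $d=a_k-1$, $q=\lfloor d/c\rfloor$, $r=d-qc$ take $(a_1,\dots,a_{k-2},c,\dots,c\ (q\text{ times}),c+r)$ if $q>1$ and $(a_1,\dots,a_{k-2},c,d)$ otherwise; for $p=3$ and $a=(1,1,1)$ take $(1,2)$). Replace $T(v)$ by the subtree where $v$ has children $u_1,\dots,u_m$ in this order, $u_i$ a leaf if $b_i=1$ and otherwise having exactly $b_i$ leaf children. (iii) Set $x:=v$ and repeat: for every child $y$ of the parent of $x$ arranged after $x$ (none if $x$ is the root), if $l(y)=l(x)$ replace $T(y)$ by a copy of the current $T(x)$, else replace $T(y)$ by a node with exactly $l(y)$ leaf children; then set $x$ to its parent; stop after processing the root. (iv) Return the tree. Procedure $\mathit{CographGeneration}(n)$: set $T_1$ to be the tree whose root has exactly $n$ children, all leaves, and $i:=1$; repeat: output $T_i^0$ and $T_i^1$; set $T_{i+1}:=\mathit{NextTree}(T_i)$ and $i:=i+1$; until $T_i$ is null. Trees are stored with each node carrying $l(v)$ and its children in their arranged order. *)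

theory Defs
  imports Main "HOL-Library.Sublist"
begin

section \<open>Graphs\<close>

text \<open>A graph is a vertex set together with a set of two-element edges.\<close>

type_synonym 'v graph = "'v set \<times> 'v set set"

definition simple_graph :: "'v graph \<Rightarrow> bool" where
  "simple_graph G \<longleftrightarrow> finite (fst G) \<and> snd G \<subseteq> {e. e \<subseteq> fst G \<and> card e = 2}"

definition graph_iso :: "'v graph \<Rightarrow> 'w graph \<Rightarrow> bool" where
  "graph_iso G H \<longleftrightarrow> (\<exists>f. bij_betw f (fst G) (fst H) \<and>
     (\<forall>u\<in>fst G. \<forall>v\<in>fst G. {u, v} \<in> snd G \<longleftrightarrow> {f u, f v} \<in> snd H))"

definition induced_subgraph :: "'v graph \<Rightarrow> 'v set \<Rightarrow> 'v graph" where
  "induced_subgraph G W = (W, {e \<in> snd G. e \<subseteq> W})"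

definition P4 :: "nat graph" where
  "P4 = ({0, 1, 2, 3}, {{0, 1}, {1, 2}, {2, 3}})"

definition cograph :: "'v graph \<Rightarrow> bool" where
  "cograph G \<longleftrightarrow> simple_graph G \<and> \<not> (\<exists>W\<subseteq>fst G. graph_iso (induced_subgraph G W) P4)"


section \<open>Cotrees\<close>

text \<open>
  The labels 0 and 1 are \<^term>\<open>False\<close> and \<^term>\<open>True\<close>. The order of the children in the list
  carries no meaning: it is disregarded by \<open>cotree_iso\<close> below.
\<close>

datatype cotree = CLeaf | CNode bool "cotree list"

fun root_label :: "cotree \<Rightarrow> bool option" where
  "root_label CLeaf = None"
| "root_label (CNode b ts) = Some b"

fun is_cotree :: "cotree \<Rightarrow> bool" where
  "is_cotree CLeaf = True"
| "is_cotree (CNode b ts) =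
     (length ts \<ge> 2 \<and> (\<forall>t\<in>set ts. is_cotree t \<and> root_label t \<noteq> Some b))"

text \<open>
  A node is identified with its address, the list of child indices on the path from the root to
  it; the lowest common ancestor of two nodes is then the longest common prefix.
\<close>

fun subtree_at :: "cotree \<Rightarrow> nat list \<Rightarrow> cotree option" where
  "subtree_at t [] = Some t"
| "subtree_at CLeaf (i # p) = None"
| "subtree_at (CNode b ts) (i # p) = (if i < length ts then subtree_at (ts ! i) p else None)"

definition nodes :: "cotree \<Rightarrow> nat list set" where
  "nodes t = {p. subtree_at t p \<noteq> None}"

definition leaves :: "cotree \<Rightarrow> nat list set" where
  "leaves t = {p. subtree_at t p = Some CLeaf}"

definition label_at :: "cotree \<Rightarrow> nat list \<Rightarrow> bool option" where
  "label_at t p = Option.bind (subtree_at t p) root_label"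

definition parent_of :: "nat list \<Rightarrow> nat list \<Rightarrow> bool" where
  "parent_of p q \<longleftrightarrow> (\<exists>i. q = p @ [i])"

definition cotree_iso :: "cotree \<Rightarrow> cotree \<Rightarrow> bool" where
  "cotree_iso t s \<longleftrightarrow> (\<exists>f. bij_betw f (nodes t) (nodes s) \<and> f [] = [] \<and>
     (\<forall>p\<in>nodes t. label_at s (f p) = label_at t p) \<and>
     (\<forall>p\<in>nodes t. \<forall>q\<in>nodes t. parent_of p q \<longleftrightarrow> parent_of (f p) (f q)))"

definition cotree_graph :: "cotree \<Rightarrow> nat list graph" where
  "cotree_graph t = (leaves t,
     {{p, q} | p q. p \<in> leaves t \<and> q \<in> leaves t \<and> p \<noteq> q \<and>
        label_at t (longest_common_prefix p q) = Some True})"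


section \<open>Computations with running time\<close>

text \<open>
  A computation is a result paired with its number of steps. Every call of a function of the
  algorithm below is charged one step, in addition to the calls it makes. Apart from
  those calls, a call performs only a bounded number of unit-cost operations: arithmetic and
  comparison of numbers, case distinction on and construction of a list cell, a pair or a node,
  and comparison of a list with a list of length two. Anything that depends on the length of a
  list or the size of a tree (building leaves, copying, reversing, reading off a partition,
  writing a cotree) is programmed out and hence charged.
\<close>

type_synonym 'a timed = "'a \<times> nat"

definition ret :: "'a \<Rightarrow> 'a timed" where
  "ret x = (x, 0)"

definition bind :: "'a timed \<Rightarrow> ('a \<Rightarrow> 'b timed) \<Rightarrow> 'b timed" (infixl "\<rhd>" 54) where
  "m \<rhd> f = (fst (f (fst m)), snd m + snd (f (fst m)))"

definition tick :: "'a timed \<Rightarrow> 'a timed" where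
  "tick m = (fst m, Suc (snd m))"


section \<open>The algorithm\<close>

text \<open>Each node stores its number of leaves and its children in their arranged order.\<close>

datatype tree = Node (num_leaves: nat) (children: "tree list")

abbreviation leaf :: tree where
  "leaf \<equiv> Node 1 []"

fun mk_leaves :: "nat \<Rightarrow> tree list timed" where
  "mk_leaves 0 = tick (ret [])"
| "mk_leaves (Suc k) = tick (mk_leaves k \<rhd> (\<lambda>us. ret (leaf # us)))"

definition star :: "nat \<Rightarrow> tree timed" where
  "star p = tick (mk_leaves p \<rhd> (\<lambda>us. ret (Node p us)))"

fun induced_partition :: "tree list \<Rightarrow> nat list timed" where
  "induced_partition [] = tick (ret [])"
| "induced_partition (u # us) =
     tick (induced_partition us \<rhd> (\<lambda>as. ret (num_leaves u # as)))"

definition exhausted :: "tree \<Rightarrow> bool timed" where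
  "exhausted v = tick (if children v = [] then ret True
     else induced_partition (children v) \<rhd>
       (\<lambda>as. ret (as = [num_leaves v div 2, (num_leaves v + 1) div 2])))"

text \<open>
  The position of a node \<open>x\<close> in a tree is given by the list of its proper ancestors, parent first;
  each is recorded with its number of leaves, its children arranged before the node below it on
  the path (nearest first), and its children arranged after that node.
\<close>

type_synonym ancestry = "(nat \<times> tree list \<times> tree list) list"

text \<open>
  Inverted post-order search: in a list of siblings the tail is searched before the head, and a
  node is inspected after all its children. In \<open>pivot_list\<close> the argument \<open>ls\<close> holds the siblings
  that precede the given list, nearest first.
\<close>

fun pivot :: "ancestry \<Rightarrow> tree \<Rightarrow> (tree \<times> ancestry) option timed"
  and pivot_list ::
    "ancestry \<Rightarrow> nat \<Rightarrow> tree list \<Rightarrow> tree list \<Rightarrow> (tree \<times> ancestry) option timed"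
where
  "pivot ctx (Node p ts) = tick (pivot_list ctx p [] ts \<rhd> (\<lambda>found. case found of
       Some z \<Rightarrow> ret (Some z)
     | None \<Rightarrow> exhausted (Node p ts) \<rhd>
         (\<lambda>e. ret (if e then None else Some (Node p ts, ctx)))))"
| "pivot_list ctx p ls [] = tick (ret None)"
| "pivot_list ctx p ls (t # ts) = tick (pivot_list ctx p (t # ls) ts \<rhd> (\<lambda>found. case found of
       Some z \<Rightarrow> ret (Some z)
     | None \<Rightarrow> pivot ((p, ls, ts) # ctx) t))"

fun prepend_copies :: "nat \<Rightarrow> nat \<Rightarrow> nat list \<Rightarrow> nat list timed" where
  "prepend_copies 0 c as = tick (ret as)"
| "prepend_copies (Suc q) c as = tick (prepend_copies q c as \<rhd> (\<lambda>bs. ret (c # bs)))"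

text \<open>The lists with fewer than two entries are not partitions; their equations are junk.\<close>

fun next_partition_end :: "nat list \<Rightarrow> nat list timed" where
  "next_partition_end [] = tick (ret [])"
| "next_partition_end [x] = tick (ret [x])"
| "next_partition_end [x, y] = tick (
     if y - x \<le> 1 then ret [x + y]
     else let c = x + 1; d = y - 1; q = d div c; r = d - q * c in
       if q > 1 then prepend_copies q c [c + r] else ret [c, d])"
| "next_partition_end (x # y # z # as) =
     tick (next_partition_end (y # z # as) \<rhd> (\<lambda>bs. ret (x # bs)))"

text \<open>
  For a partition of \<open>p\<close> that is not the maximum, the first entry is \<open>p div 2\<close> only for \<open>p = 3\<close> and
  \<open>(1, 1, 1)\<close>.
\<close>

definition next_partition :: "nat \<Rightarrow> nat list \<Rightarrow> nat list timed" where
  "next_partition p as =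
     tick (if hd as \<noteq> p div 2 then next_partition_end as else ret [1, 2])"

fun mk_children :: "nat list \<Rightarrow> tree list timed" where
  "mk_children [] = tick (ret [])"
| "mk_children (b # bs) = tick ((if b = 1 then ret leaf else star b) \<rhd> (\<lambda>u.
     mk_children bs \<rhd> (\<lambda>us. ret (u # us))))"

fun copy :: "tree \<Rightarrow> tree timed"
  and copy_list :: "tree list \<Rightarrow> tree list timed"
where
  "copy (Node p ts) = tick (copy_list ts \<rhd> (\<lambda>us. ret (Node p us)))"
| "copy_list [] = tick (ret [])"
| "copy_list (t # ts) = tick (copy t \<rhd> (\<lambda>u. copy_list ts \<rhd> (\<lambda>us. ret (u # us))))"

fun replace_later :: "tree \<Rightarrow> tree list \<Rightarrow> tree list timed" where
  "replace_later x [] = tick (ret [])"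
| "replace_later x (y # ys) =
     tick ((if num_leaves y = num_leaves x then copy x else star (num_leaves y)) \<rhd> (\<lambda>u.
       replace_later x ys \<rhd> (\<lambda>us. ret (u # us))))"

fun rev_onto :: "tree list \<Rightarrow> tree list \<Rightarrow> tree list timed" where
  "rev_onto [] us = tick (ret us)"
| "rev_onto (t # ts) us = tick (rev_onto ts (t # us))"

fun ascend :: "tree \<Rightarrow> ancestry \<Rightarrow> tree timed" where
  "ascend x [] = tick (ret x)"
| "ascend x ((p, ls, rs) # ctx) = tick (replace_later x rs \<rhd> (\<lambda>us.
     rev_onto ls (x # us) \<rhd> (\<lambda>ts. ascend (Node p ts) ctx)))"

definition next_tree :: "tree \<Rightarrow> tree option timed" where
  "next_tree t = tick (pivot [] t \<rhd> (\<lambda>found. case found of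
       None \<Rightarrow> ret None
     | Some (v, ctx) \<Rightarrow>
         induced_partition (children v) \<rhd> (\<lambda>as.
         next_partition (num_leaves v) as \<rhd> (\<lambda>bs.
         mk_children bs \<rhd> (\<lambda>us.
         ascend (Node (num_leaves v) us) ctx \<rhd> (\<lambda>t'. ret (Some t')))))))"

text \<open>Writing out the cotree obtained by giving the root the label \<open>b\<close>.\<close>

fun write_cotree :: "bool \<Rightarrow> tree \<Rightarrow> cotree timed"
  and write_cotree_list :: "bool \<Rightarrow> tree list \<Rightarrow> cotree list timed"
where
  "write_cotree b (Node p ts) = tick (if ts = [] then ret CLeaf
     else write_cotree_list (\<not> b) ts \<rhd> (\<lambda>cs. ret (CNode b cs)))"
| "write_cotree_list b [] = tick (ret [])"
| "write_cotree_list b (t # ts) = tick (write_cotree b t \<rhd> (\<lambda>c.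
     write_cotree_list b ts \<rhd> (\<lambda>cs. ret (c # cs))))"

text \<open>
  \<open>generation n i\<close> is the tree \<open>T_(i+1)\<close> (or null) together with the time at which it has been
  computed. Once null is reached the run is over, and the sequence stays constant.
\<close>

fun generation :: "nat \<Rightarrow> nat \<Rightarrow> tree option timed" where
  "generation n 0 = tick (star n \<rhd> (\<lambda>t. ret (Some t)))"
| "generation n (Suc i) = (case generation n i of
       (None, s) \<Rightarrow> (None, s)
     | (Some t, s) \<Rightarrow> (Some t, s) \<rhd> (\<lambda>_. tick (
         write_cotree False t \<rhd> (\<lambda>_. write_cotree True t \<rhd> (\<lambda>_. next_tree t)))))"

text \<open>
  \<open>nth_output n k\<close> is the \<open>k\<close>-th output (counting from 0) of the run on input \<open>n\<close>, with the time at which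
  it has been written, or \<^term>\<open>None\<close> if the run makes at most \<open>k\<close> outputs. Outputs \<open>2 * i\<close> and
  \<open>2 * i + 1\<close> come from the same tree, with root label 0 and 1, respectively.
\<close>

definition nth_output :: "nat \<Rightarrow> nat \<Rightarrow> cotree timed option" where
  "nth_output n k = (case generation n (k div 2) of
       (None, s) \<Rightarrow> None
     | (Some t, s) \<Rightarrow> Some ((Some t, s) \<rhd> (\<lambda>_. tick (
         if even k then write_cotree False t
         else write_cotree False t \<rhd> (\<lambda>_. write_cotree True t)))))"

end

theory Submission
  imports Defs "HOL-Library.List_Lexorder" "HOL-Combinatorics.List_Permutation"
begin

text \<open>
  Comparing nodes amounts to comparing words lexicographically, which makes the ordered trees with \<open>n\<close>
  leaves a finite linear order whose least element is the star. The pivot is the last place at which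
  the tree can be increased, since everything visited before it is maximal; the procedure increases
  it there by the least amount and makes everything arranged later minimal. Hence each tree is
  followed by its immediate successor, and the run passes through all ordered trees, once each.
  The cotree of a graph is unique because the children of its root correspond to the components of
  the graph or of its complement, and it exists because the vertices of a \<open>P\<^sub>4\<close>-free graph can be cut
  into two parts with all or no edges between them. The delay is linear because a tree with \<open>n\<close> leaves
  has at most \<open>2 n - 1\<close> nodes, and a step inspects or writes each of them a bounded number of times.
\<close>

text \<open>The arrangement of siblings is the obstacle: once a child has grown, the later ones are
  not free to become arbitrary stars. One with as many leaves as the grown child must not lie below
  it, so its least value is a copy; one with more leaves lies above it in any case, so its least
  value is a star. Both cases arise from minimizing a list of children whose leaf counts are kept
  fixed; the leaf counts themselves change only at the pivot.

  Copying does not spoil the linear bound: the work at one level of the ascent is charged to the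
  leaves below the parent that are not below the child, and these sets are disjoint for different
  levels.

  The two outputs of one tree differ because the root label tells which of the graph and its
  complement is disconnected, and on at least two vertices this is never both. The graph also
  determines the vertex sets of the root's children, hence by induction the children up to order,
  and sorting by an injective encoding removes the remaining freedom.\<close>

lemma fst_ret [simp]: "fst (ret x) = x" and snd_ret [simp]: "snd (ret x) = 0"
  by (simp_all add: ret_def)

lemma fst_bind [simp]: "fst (m \<rhd> f) = fst (f (fst m))"
  and snd_bind [simp]: "snd (m \<rhd> f) = snd m + snd (f (fst m))"
  by (simp_all add: bind_def)

lemma fst_tick [simp]: "fst (tick m) = fst m" and snd_tick [simp]: "snd (tick m) = Suc (snd m)"
  by (simp_all add: tick_def)

text \<open>One notion serves partitions, forests and trees: \<open>None\<close> marks a greatest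
  element with respect to the key \<open>f\<close>, \<open>Some z\<close> a least element among
  those above \<open>x\<close>.\<close>

fun is_next :: "'a set \<Rightarrow> ('a \<Rightarrow> 'b::linorder) \<Rightarrow> 'a \<Rightarrow> 'a option \<Rightarrow> bool" where
  "is_next A f x None \<longleftrightarrow> (\<forall>y\<in>A. f y \<le> f x)"
| "is_next A f x (Some z) \<longleftrightarrow> z \<in> A \<and> f x < f z \<and> (\<forall>y\<in>A. f x < f y \<longrightarrow> f z \<le> f y)"

section \<open>Partitions\<close>

definition partitions :: "nat \<Rightarrow> nat list set" where
  "partitions p = {as. sorted as \<and> 0 \<notin> set as \<and> sum_list as = p}"

lemma partitions_Nil [simp]: "[] \<in> partitions p \<longleftrightarrow> p = 0"
  by (auto simp: partitions_def)

lemma partitions_Cons: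
  "a # as \<in> partitions p \<longleftrightarrow> 0 < a \<and> a \<le> p \<and> as \<in> partitions (p - a) \<and> (\<forall>b\<in>set as. a \<le> b)"
  by (auto simp: partitions_def)

lemma partitions_0: "as \<in> partitions 0 \<Longrightarrow> as = []"
  by (cases as) (auto simp: partitions_def)

text \<open>After cancelling equal heads one list runs out first; what remains of the other has sum
  0 and positive entries, so it is empty. The known sum acts as an end marker.\<close>

lemma pos_parts_eq_if_append_eq:
  assumes "as @ xs = bs @ ys" "0 \<notin> set as" "0 \<notin> set bs" "sum_list as = sum_list (bs :: nat list)"
  shows "as = bs"
  using assms
proof (induction as arbitrary: bs)
  case Nil
  then show ?case by (cases bs) auto
next
  case (Cons a as)
  then show ?case by (cases bs) auto
qed

text \<open>The greedy choice: exceeding \<open>c\<close> at an earlier position is already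
  lexicographically larger, and the final \<open>c + r\<close> is below \<open>2 * c\<close>, so it
  cannot be split into entries of at least \<open>c\<close>.\<close>

lemma least_partition_with_parts_ge:
  assumes "\<forall>a\<in>set as. c \<le> a" "0 < c" "r < c" "sum_list as = q * c + (c + r)"
  shows "replicate q c @ [c + r] \<le> as"
  using assms(1,4)
proof (induction q arbitrary: as)
  case 0
  then obtain a as' where as: "as = a # as'" using \<open>0 < c\<close> by (cases as) auto
  show ?case
  proof (cases as')
    case Nil
    then show ?thesis using as 0 by auto
  next
    case (Cons a' as'')
    then show ?thesis using as 0 \<open>r < c\<close> by auto
  qed
next
  case (Suc q)
  then obtain a as' where as: "as = a # as'" using \<open>0 < c\<close> by (cases as) auto
  show ?case
  proof (cases "a = c")
    case True
    then have "replicate q c @ [c + r] \<le> as'" using Suc as by auto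
    then show ?thesis using True as by simp
  next
    case False
    then show ?thesis using Suc.prems(1) as by auto
  qed
qed

lemma least_partition: "\<lbrakk>0 \<notin> set as; sum_list as = p\<rbrakk> \<Longrightarrow> replicate p 1 \<le> as"
proof (cases p)
  case (Suc q)
  moreover assume "0 \<notin> set as" "sum_list as = p"
  moreover from this have "\<forall>a\<in>set as. 1 \<le> a" by (metis less_one linorder_not_less)
  ultimately have "replicate q 1 @ [1 + 0] \<le> as"
    by (intro least_partition_with_parts_ge) auto
  then show ?thesis using Suc by (simp add: replicate_append_same)
qed auto

lemma no_partition_gt_single: "as \<in> partitions p \<Longrightarrow> \<not> [p] < as"
  by (cases as) (auto simp: partitions_Cons dest: partitions_0)

lemma prepend_copies_eq [simp]: "fst (prepend_copies q c as) = replicate q c @ as"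
  by (induction q) auto

text \<open>The branch that returns \<open>[c, d]\<close> for \<open>q = 1\<close> has the same form
  as the other one, since then \<open>d = c + r\<close>. This puts both in reach of the greedy bound
  with least entry \<open>x + 1\<close>.\<close>

lemma next_partition_end_pair:
  assumes "x + 2 \<le> y" "0 < x"
  obtains q r where "0 < q" "r < x + 1" "x + y = q * (x + 1) + (x + 1 + r)"
    "fst (next_partition_end [x, y]) = replicate q (x + 1) @ [x + 1 + r]"
proof
  define q where "q = (y - 1) div (x + 1)"
  define r where "r = (y - 1) - q * (x + 1)"
  have r: "r = (y - 1) mod (x + 1)"
    unfolding r_def q_def by (rule minus_div_mult_eq_mod)
  have yq: "y - 1 = q * (x + 1) + r"
    unfolding r q_def by (rule div_mult_mod_eq[symmetric])
  show "0 < q" using assms by (simp add: q_def div_greater_zero_iff)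
  show "r < x + 1" unfolding r by simp
  show "x + y = q * (x + 1) + (x + 1 + r)" using yq assms by simp
  have "fst (next_partition_end [x, y]) =
    (if q > 1 then replicate q (x + 1) @ [x + 1 + r] else [x + 1, y - 1])"
    using assms by (simp add: Let_def q_def[symmetric] r_def[symmetric] flip: Suc_eq_plus1)
      (simp add: q_def r_def)
  then show "fst (next_partition_end [x, y]) = replicate q (x + 1) @ [x + 1 + r]"
    using yq \<open>0 < q\<close> by (cases "q = 1") auto
qed

lemma next_partition_end_is_next:
  assumes "as \<in> partitions p" "2 \<le> length as"
  shows "is_next (partitions p) (\<lambda>as. as) as (Some (fst (next_partition_end as))) \<and>
    (\<forall>b\<in>set (fst (next_partition_end as)). hd as \<le> b)"
  using assms
proof (induction as arbitrary: p rule: next_partition_end.induct)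
  case (3 x y)
  have xy: "0 < x" "x \<le> y" "p = x + y"
    using 3 by (auto simp: partitions_Cons)
  show ?case
  proof (cases "y - x \<le> 1")
    case True
    have "[x + y] \<le> cs" if cs: "cs \<in> partitions p" "[x, y] < cs" for cs
    proof (cases cs)
      case (Cons c cs')
      \<comment> \<open>With first entry \<open>x\<close> kept, the tail would have to exceed
        \<open>[y]\<close>, the greatest partition of \<open>y\<close>.\<close>
      have "\<not> [y] < cs'" if "c = x"
        using cs Cons that no_partition_gt_single[of cs' y] by (auto simp: partitions_Cons xy)
      then have c: "x < c" using cs Cons by auto
      show ?thesis
      proof (cases cs')
        case Nil
        then show ?thesis using cs Cons by (auto simp: partitions_Cons xy)
      next
        case (Cons c' cs'')
        \<comment> \<open>Two entries of at least \<open>x + 1\<close> would exceed the sum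
          \<open>x + y\<close>, as \<open>y\<close> is at most \<open>x + 1\<close>.\<close>
        then have "c \<le> c'" "c + c' \<le> x + y" using cs \<open>cs = _\<close>
          by (auto simp: partitions_Cons xy)
        then show ?thesis using c True xy by auto
      qed
    qed (use cs in auto)
    then show ?thesis using True xy by (auto simp: partitions_Cons)
  next
    case False
    then obtain q r where q: "0 < q" "r < x + 1" "x + y = q * (x + 1) + (x + 1 + r)"
      "fst (next_partition_end [x, y]) = replicate q (x + 1) @ [x + 1 + r]"
      using next_partition_end_pair[of x y] xy(1) by (metis add.commute le_diff_conv2 not_less_eq_eq one_add_one plus_1_eq_Suc xy(2))
    have "replicate q (x + 1) @ [x + 1 + r] \<le> cs" if cs: "cs \<in> partitions p" "[x, y] < cs" for cs
    proof (rule least_partition_with_parts_ge)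
      obtain c cs' where Cons: "cs = c # cs'" using cs xy by (cases cs) auto
      have "\<not> [y] < cs'" if "c = x"
        using cs Cons that no_partition_gt_single[of cs' y] by (auto simp: partitions_Cons xy)
      then have "x < c" using cs Cons by auto
      then show "\<forall>a\<in>set cs. x + 1 \<le> a" using cs Cons by (fastforce simp: partitions_Cons)
      show "sum_list cs = q * (x + 1) + (x + 1 + r)" using cs(1) xy q(3) by (simp add: partitions_def)
    qed (use q in auto)
    moreover have "replicate q (x + 1) @ [x + 1 + r] \<in> partitions p"
      using q xy by (simp add: partitions_def sorted_append sum_list_replicate)
    moreover have "[x, y] < replicate q (x + 1) @ [x + 1 + r]"
      using q(1) by (cases q) auto
    ultimately show ?thesis by (simp del: next_partition_end.simps add: q(4))
  qed
next
  case (4 x y z as)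
  have x: "0 < x" "x \<le> p" "y # z # as \<in> partitions (p - x)" "x \<le> y"
    using 4(2) unfolding partitions_Cons[of x] by auto
  define bs where "bs = fst (next_partition_end (y # z # as))"
  have bs: "is_next (partitions (p - x)) (\<lambda>as. as) (y # z # as) (Some bs)" "\<forall>b\<in>set bs. y \<le> b"
    using 4(1)[OF x(3)] by (auto simp: bs_def)
  have "x # bs \<le> cs" if cs: "cs \<in> partitions p" "x # y # z # as < cs" for cs
  proof (cases cs)
    case (Cons c cs')
    show ?thesis
    proof (cases "c = x")
      case True
      then have "bs \<le> cs'" using cs bs(1) Cons by (auto simp: partitions_Cons)
      then show ?thesis using True Cons by simp
    qed (use cs Cons in auto)
  qed (use cs in auto)
  moreover have "\<forall>b\<in>set bs. x \<le> b" using bs(2) x(4) by auto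
  ultimately show ?case using x bs(1) by (simp add: bs_def[symmetric] partitions_Cons[of x])
qed auto

section \<open>Partitions with at least two entries\<close>

definition max_partition :: "nat \<Rightarrow> nat list" where
  "max_partition p = [p div 2, (p + 1) div 2]"

lemma max_partition_greatest:
  assumes "as \<in> partitions p" "2 \<le> length as"
  shows "as \<le> max_partition p"
proof -
  obtain x y as' where as: "as = x # y # as'"
    using assms(2) by (cases as; cases "tl as") auto
  have xy: "x \<le> y" "x + y + sum_list as' = p" "0 \<notin> set as'"
    using assms(1) as by (auto simp: partitions_def)
  then have "x \<le> p div 2" by auto
  moreover have "y # as' \<le> [(p + 1) div 2]" if "x = p div 2"
  proof -
    have "y + sum_list as' = (p + 1) div 2" using xy that by auto
    moreover have "as' = []" if "sum_list as' = 0" using that xy(3) by (cases as') auto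
    ultimately show ?thesis by (cases "sum_list as' = 0") (simp_all del: sum_list_eq_0_iff)
  qed
  ultimately show ?thesis using as by (auto simp: max_partition_def)
qed

text \<open>The special branch is reached only by \<open>(1, 1, 1)\<close>, where the general rule
  gives the same result: three entries of at least \<open>x\<close> with sum at most
  \<open>2 * x + 1\<close> force \<open>x = 1\<close>.\<close>

lemma next_partition_eq:
  assumes "as \<in> partitions p" "2 \<le> length as" "as \<noteq> max_partition p"
  shows "fst (next_partition p as) = fst (next_partition_end as)"
proof (cases "hd as = p div 2")
  case True
  obtain x y as' where as: "as = x # y # as'"
    using assms(2) by (cases as; cases "tl as") auto
  have xy: "x = p div 2" "x \<le> y" "\<forall>a\<in>set as'. y \<le> a" "x + y + sum_list as' = p" "0 < x"
    using assms(1) as True by (auto simp: partitions_def)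
  show ?thesis
  proof (cases as')
    case Nil
    then have "as = max_partition p" using as xy by (auto simp: max_partition_def)
    then show ?thesis using assms by simp
  next
    case (Cons z as'')
    then have "z \<ge> y" "x + y + z + sum_list as'' = p" using xy by auto
    moreover have "p \<le> 2 * x + 1" using xy(1) by simp
    ultimately have "x = 1" "y = 1" "z = 1" "sum_list as'' = 0"
      using xy(2,5) by linarith+
    moreover from this have "as'' = []"
      using assms(1) Cons as by (cases as'') (auto simp: partitions_def)
    ultimately show ?thesis using as Cons xy by (simp add: next_partition_def)
  qed
qed (simp add: next_partition_def)

text \<open>Merging yields a single entry only from \<open>[x, y]\<close> with
  \<open>y \<le> x + 1\<close>, which is the maximal partition. In a longer list the first entry is
  kept and the tail grows, so the tail is nonempty.\<close>

lemma length_next_partition_end: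
  assumes "as \<in> partitions p" "2 \<le> length as" "as \<noteq> max_partition p"
  shows "2 \<le> length (fst (next_partition_end as))"
proof (cases as rule: next_partition_end.cases)
  case (3 x y)
  then have "0 < x" "x \<le> y" "p = x + y" using assms by (auto simp: partitions_Cons)
  moreover from this have "x + 2 \<le> y" using assms 3 by (auto simp: max_partition_def)
  ultimately obtain q r where "0 < q" "fst (next_partition_end [x, y]) = replicate q (x + 1) @ [x + 1 + r]"
    using next_partition_end_pair[of x y] by blast
  then show ?thesis using 3 by (cases q) auto
next
  case (4 x y z as')
  have "fst (next_partition_end (y # z # as')) \<noteq> []"
  proof -
    have "y # z # as' \<in> partitions (p - x)"
      using assms(1) unfolding 4 partitions_Cons[of x] by blast
    then have "y # z # as' < fst (next_partition_end (y # z # as'))"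
      using next_partition_end_is_next by fastforce
    then show ?thesis by force
  qed
  then show ?thesis using 4 by (cases "fst (next_partition_end (y # z # as'))") auto
qed (use assms in auto)

definition proper_partitions :: "nat \<Rightarrow> nat list set" where
  "proper_partitions p = {as \<in> partitions p. 2 \<le> length as}"

lemma next_partition_is_next:
  assumes "as \<in> proper_partitions p"
  shows "is_next (proper_partitions p) (\<lambda>as. as) as
    (if as = max_partition p then None else Some (fst (next_partition p as)))"
  using assms next_partition_end_is_next[of as p] length_next_partition_end[of as p]
    max_partition_greatest
  by (auto simp: proper_partitions_def next_partition_eq)

section \<open>The order on trees\<close>

text \<open>
  The comparison of nodes is the lexicographic order on the following encoding. This is because the
  induced partitions of two nodes with the same number of leaves are never proper prefixes of each
  other, and hence neither are the encodings of two ordered trees.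
\<close>

fun encode :: "tree \<Rightarrow> nat list" where
  "encode (Node p ts) = p # map num_leaves ts @ concat (map encode ts)"

fun valid :: "tree \<Rightarrow> bool" where
  "valid (Node p ts) \<longleftrightarrow> (if ts = [] then p = 1 else length ts \<ge> 2 \<and>
     p = sum_list (map num_leaves ts) \<and> sorted (map encode ts) \<and> (\<forall>t\<in>set ts. valid t))"

definition valid_forest :: "tree list \<Rightarrow> bool" where
  "valid_forest ts \<longleftrightarrow> sorted (map encode ts) \<and> (\<forall>t\<in>set ts. valid t)"

definition trees :: "nat \<Rightarrow> tree set" where
  "trees n = {t. valid t \<and> num_leaves t = n}"

text \<open>Fixing the leaf counts isolates the case of equal induced partitions, in which nodes are
  compared child by child.\<close>

definition forests :: "nat list \<Rightarrow> tree list set" where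
  "forests as = {ts. valid_forest ts \<and> map num_leaves ts = as}"

lemma valid_forest_Nil [simp]: "valid_forest []"
  by (simp add: valid_forest_def)

lemma valid_forest_Cons:
  "valid_forest (t # ts) \<longleftrightarrow> valid t \<and> valid_forest ts \<and> (\<forall>s\<in>set ts. encode t \<le> encode s)"
  by (auto simp: valid_forest_def)

lemma num_leaves_mono: "encode t \<le> encode s \<Longrightarrow> num_leaves t \<le> num_leaves s"
  by (cases t; cases s) auto

lemma encode_less_if_num_leaves_less: "num_leaves t < num_leaves s \<Longrightarrow> encode t < encode s"
  by (cases t; cases s) auto

lemma num_leaves_pos: "valid t \<Longrightarrow> 0 < num_leaves t"
proof (induction t)
  case (Node p ts)
  then show ?case by (cases ts) auto
qed

lemma valid_Node_iff:
  "valid (Node p ts) \<longleftrightarrow> p = 1 \<and> ts = [] \<or>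
     valid_forest ts \<and> map num_leaves ts \<in> proper_partitions p"
proof -
  have "sorted (map num_leaves ts)" if "sorted (map encode ts)"
    using that by (auto simp: sorted_iff_nth_mono intro!: num_leaves_mono)
  moreover have "0 \<notin> set (map num_leaves ts)" if "\<forall>t\<in>set ts. valid t"
    using that num_leaves_pos by fastforce
  ultimately show ?thesis
    by (auto simp: valid_forest_def proper_partitions_def partitions_def)
qed

declare valid.simps [simp del]

lemma proper_partitions_ge_2: "as \<in> proper_partitions p \<Longrightarrow> 2 \<le> p"
  by (cases as; cases "tl as") (auto simp: proper_partitions_def partitions_def)

lemma valid_leaf [simp]: "valid (Node (Suc 0) [])"
  by (simp add: valid_Node_iff)

lemma trees_1: "trees 1 = {leaf}"
proof -
  have "t = leaf" if "valid t" "num_leaves t = 1" for t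
    using that by (cases t) (auto simp: valid_Node_iff dest!: proper_partitions_ge_2)
  then show ?thesis by (auto simp: trees_def)
qed

lemma Node_in_trees_iff:
  "2 \<le> p \<Longrightarrow> Node p ts \<in> trees p \<longleftrightarrow> valid_forest ts \<and> map num_leaves ts \<in> proper_partitions p"
  by (auto simp: trees_def valid_Node_iff)

lemma trees_casesE:
  assumes "t \<in> trees p" "2 \<le> p"
  obtains ts where "t = Node p ts" "valid_forest ts" "map num_leaves ts \<in> proper_partitions p"
  using assms by (cases t) (auto simp: trees_def valid_Node_iff)

section \<open>Unique readability of the encodings\<close>

lemma append_less_append_same [simp]: "us @ xs < us @ ys \<longleftrightarrow> xs < (ys :: 'a::linorder list)"
  by (induction us) auto

lemma append_less_append_if_not_prefix:
  "\<lbrakk>\<not> prefix us vs; \<not> prefix vs us\<rbrakk> \<Longrightarrow> us @ xs < vs @ ys \<longleftrightarrow> us < (vs :: 'a::linorder list)"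
proof (induction us arbitrary: vs)
  case (Cons u us)
  then show ?case by (cases vs) auto
qed auto

text \<open>Unique readability of the single trees is a premise, so that this can be applied inside
  the induction that establishes it.\<close>

lemma concat_encode_append_inject:
  assumes "\<And>t s xs ys. \<lbrakk>t \<in> set ts; valid t; valid s; encode t @ xs = encode s @ ys\<rbrakk> \<Longrightarrow> t = s \<and> xs = ys"
    and "length ts = length ss" "\<forall>t\<in>set ts. valid t" "\<forall>s\<in>set ss. valid s"
    and "concat (map encode ts) @ xs = concat (map encode ss) @ ys"
  shows "ts = ss \<and> xs = ys"
  using assms(2,1,3-)
proof (induction ts ss rule: list_induct2)
  case (Cons t ts s ss)
  have "t = s \<and> concat (map encode ts) @ xs = concat (map encode ss) @ ys"
    using Cons.prems(2-4) by (intro Cons.prems(1)) auto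
  moreover from this have "ts = ss \<and> xs = ys"
  proof (intro Cons.IH)
    show "t' = s' \<and> xs' = ys'" if "t' \<in> set ts" "valid t'" "valid s'" "encode t' @ xs' = encode s' @ ys'"
      for t' s' xs' ys'
      using Cons.prems(1)[of t' s' xs' ys'] that by simp
  qed (use Cons.prems(2,3) in auto)
  ultimately show ?case by simp
qed auto

text \<open>The encodings form a prefix code, whatever text follows: the first number
  \<open>p\<close> is the sum at which the induced partition ends, its length is the number of
  children, and these are read one after the other.\<close>

lemma encode_append_inject:
  "\<lbrakk>valid t; valid s; encode t @ xs = encode s @ ys\<rbrakk> \<Longrightarrow> t = s \<and> xs = ys"
proof (induction t arbitrary: s xs ys)
  case (Node p ts)
  obtain ss where s: "s = Node p ss" using Node.prems(3) by (cases s) auto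
  show ?case
  proof (cases "p = 1")
    case True
    then have "Node p ts \<in> trees 1" "s \<in> trees 1" using Node.prems s by (auto simp: trees_def)
    then show ?thesis using Node.prems unfolding trees_1 by auto
  next
    case False
    then have v: "valid_forest ts" "map num_leaves ts \<in> proper_partitions p"
      "valid_forest ss" "map num_leaves ss \<in> proper_partitions p"
      using Node.prems s by (auto simp: valid_Node_iff)
    have eq: "map num_leaves ts @ concat (map encode ts) @ xs =
        map num_leaves ss @ concat (map encode ss) @ ys"
      using Node.prems(3) s by simp
    then have parts: "map num_leaves ts = map num_leaves ss"
      using v by (intro pos_parts_eq_if_append_eq[OF eq]) (auto simp: proper_partitions_def partitions_def)
    have "ts = ss \<and> xs = ys"
    proof (rule concat_encode_append_inject)
      show "length ts = length ss" using parts map_eq_imp_length_eq by blast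
      show "concat (map encode ts) @ xs = concat (map encode ss) @ ys" using eq parts by simp
    qed (use Node.IH in blast, use v in \<open>simp_all add: valid_forest_def\<close>)
    then show ?thesis using s by simp
  qed
qed

lemma encode_inject: "\<lbrakk>valid t; valid s\<rbrakk> \<Longrightarrow> encode t = encode s \<longleftrightarrow> t = s"
  using encode_append_inject[of t s "[]" "[]"] by auto

lemma not_prefix_encode: "\<lbrakk>valid t; valid s; t \<noteq> s\<rbrakk> \<Longrightarrow> \<not> prefix (encode t) (encode s)"
  using encode_append_inject[of t s _ "[]"] by (auto simp: prefix_def)

text \<open>Different code words are not prefixes of each other, so the first differing word decides
  even after the word boundaries are erased.\<close>

lemma concat_encode_less_iff:
  assumes "length ts = length ss" "\<forall>t\<in>set ts. valid t" "\<forall>s\<in>set ss. valid s"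
  shows "concat (map encode ts) < concat (map encode ss) \<longleftrightarrow> map encode ts < map encode ss"
  using assms
proof (induction ts ss rule: list_induct2)
  case (Cons t ts s ss)
  show ?case
  proof (cases "t = s")
    case False
    then show ?thesis using Cons.prems
      by (simp add: append_less_append_if_not_prefix not_prefix_encode encode_inject)
  qed (use Cons in auto)
qed auto

lemma not_prefix_partition:
  assumes "as \<in> proper_partitions p" "bs \<in> proper_partitions p" "as \<noteq> bs"
  shows "\<not> prefix as bs"
proof
  assume "prefix as bs"
  then obtain xs where eq: "as @ xs = bs @ []" by (auto simp: prefix_def)
  have "as = bs"
    using assms by (intro pos_parts_eq_if_append_eq[OF eq]) (simp_all add: proper_partitions_def partitions_def)
  then show False using assms(3) by simp
qed

text \<open>This recovers the recursive comparison of nodes with equally many leaves. Different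
  partitions of \<open>p\<close> already differ at some common position, so the words of the
  children matter only if the partitions agree.\<close>

lemma encode_Node_less_iff:
  assumes "Node p ts \<in> trees p" "Node p ss \<in> trees p" "2 \<le> p"
  shows "encode (Node p ts) < encode (Node p ss) \<longleftrightarrow> map num_leaves ts < map num_leaves ss \<or>
    map num_leaves ts = map num_leaves ss \<and> map encode ts < map encode ss"
proof (cases "map num_leaves ts = map num_leaves ss")
  case True
  moreover from this have "length ts = length ss" using map_eq_imp_length_eq by blast
  ultimately show ?thesis
    using concat_encode_less_iff[of ts ss] assms by (simp add: Node_in_trees_iff valid_forest_def)
next
  case False
  have "\<not> prefix (map num_leaves ts) (map num_leaves ss)" "\<not> prefix (map num_leaves ss) (map num_leaves ts)"
    using False not_prefix_partition assms by (metis Node_in_trees_iff)+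
  then show ?thesis
    using False by (simp add: append_less_append_if_not_prefix)
qed

section \<open>Least trees and finiteness\<close>

lemma map_encode_mono:
  "list_all2 (\<lambda>t s. encode t \<le> encode s) ts ss \<Longrightarrow> map encode ts \<le> map encode ss"
  by (induction rule: list_all2_induct) auto

definition flat :: "nat \<Rightarrow> tree" where
  "flat p = Node p (replicate p leaf)"

text \<open>\<open>flat 1\<close> has a node with a single child, which is not a valid tree; hence
  the case distinction.\<close>

definition least_tree :: "nat \<Rightarrow> tree" where
  "least_tree p = (if p = 1 then leaf else flat p)"

lemma num_leaves_least_tree [simp]: "num_leaves (least_tree p) = p"
  by (simp add: least_tree_def flat_def)

lemma valid_least_tree: "0 < p \<Longrightarrow> valid (least_tree p)"
  by (auto simp: least_tree_def flat_def valid.simps sum_list_replicate)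

text \<open>The all-ones partition is the least one, and the star is the only tree that induces
  it.\<close>

lemma least_tree_le:
  assumes "t \<in> trees p"
  shows "encode (least_tree p) \<le> encode t"
proof (cases "p = 1")
  case True
  then show ?thesis using assms trees_1 by (auto simp: least_tree_def)
next
  case False
  moreover have "0 < p" using assms num_leaves_pos by (auto simp: trees_def)
  ultimately have p: "2 \<le> p" by simp
  with assms obtain ts where t: "t = Node p ts" and f: "valid_forest ts"
    and pp: "map num_leaves ts \<in> proper_partitions p"
    by (rule trees_casesE)
  have "replicate p 1 \<le> map num_leaves ts"
    using pp by (intro least_partition) (auto simp: proper_partitions_def partitions_def)
  moreover have "ts = replicate p leaf" if parts: "map num_leaves ts = replicate p 1"
  proof (rule replicate_eqI)
    show "length ts = p" using arg_cong[OF parts, of length] by simp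
    fix s assume "s \<in> set ts"
    then have "num_leaves s = 1" "valid s"
      using arg_cong[OF parts, of set] p f by (auto simp: valid_forest_def)
    then show "s = leaf" using trees_1 by (auto simp: trees_def)
  qed
  moreover have "Node p (replicate p leaf) \<in> trees p"
    using valid_least_tree[of p] p by (simp add: least_tree_def flat_def trees_def)
  ultimately have "\<not> encode t < encode (Node p (replicate p leaf))"
    using encode_Node_less_iff[of p ts "replicate p leaf"] assms t p
    by (auto simp del: encode.simps)
  then show ?thesis using False by (simp add: least_tree_def flat_def del: encode.simps)
qed

lemma finite_trees: "finite (trees n)"
proof (induction n rule: less_induct)
  case (less n)
  show ?case
  proof (cases "2 \<le> n")
    case True
    have "trees n \<subseteq> Node n ` {ts. set ts \<subseteq> (\<Union>m<n. trees m) \<and> length ts \<le> n}"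
    proof
      fix t assume "t \<in> trees n"
      then obtain ts where t: "t = Node n ts" and f: "valid_forest ts"
        and pp: "map num_leaves ts \<in> proper_partitions n"
        using True by (rule trees_casesE)
      have pos: "0 < num_leaves s" if "s \<in> set ts" for s
        using f that num_leaves_pos by (auto simp: valid_forest_def)
      have "length us \<le> sum_list (map num_leaves us)" if "set us \<subseteq> set ts" for us
        using that
      proof (induction us)
        case (Cons u us)
        then show ?case using pos[of u] by auto
      qed simp
      \<comment> \<open>Some other child takes away at least one leaf, so the induction hypothesis
        covers all children.\<close>
      moreover have "num_leaves s < n" if "s \<in> set ts" for s
      proof -
        obtain xs ys where ts: "ts = xs @ s # ys" using split_list[of s ts] \<open>s \<in> set ts\<close> by blast
        moreover have "xs \<noteq> [] \<or> ys \<noteq> []" using ts pp by (auto simp: proper_partitions_def)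
        then have "0 < sum_list (map num_leaves xs) \<or> 0 < sum_list (map num_leaves ys)"
          using pos ts by (cases xs; cases ys) auto
        ultimately show ?thesis using pp by (auto simp: proper_partitions_def partitions_def)
      qed
      ultimately have "length ts \<le> n" "set ts \<subseteq> (\<Union>m<n. trees m)"
        using f pp by (auto simp: trees_def valid_forest_def proper_partitions_def partitions_def)
      then show "t \<in> Node n ` {ts. set ts \<subseteq> (\<Union>m<n. trees m) \<and> length ts \<le> n}"
        using t by blast
    qed
    moreover have "finite (Node n ` {ts. set ts \<subseteq> (\<Union>m<n. trees m) \<and> length ts \<le> n})"
      using less by (intro finite_imageI finite_lists_length_le) blast
    ultimately show ?thesis by (rule finite_subset)
  next
    case False
    then consider "n = 0" | "n = 1" by linarith
    then show ?thesis
    proof cases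
      case 1
      then have "trees n = {}" using num_leaves_pos by (auto simp: trees_def)
      then show ?thesis by simp
    next
      case 2
      then show ?thesis using trees_1 by simp
    qed
  qed
qed

section \<open>The successor of a tree\<close>

lemma mk_leaves_eq [simp]: "fst (mk_leaves k) = replicate k leaf"
  by (induction k) auto

lemma star_eq [simp]: "fst (star p) = flat p"
  by (simp add: star_def flat_def)

lemma induced_partition_eq [simp]: "fst (induced_partition ts) = map num_leaves ts"
  by (induction ts) auto

lemma exhausted_eq [simp]:
  "fst (exhausted v) \<longleftrightarrow> children v = [] \<or> map num_leaves (children v) = max_partition (num_leaves v)"
  by (simp add: exhausted_def max_partition_def)

lemma mk_children_eq [simp]: "fst (mk_children bs) = map least_tree bs"
  by (induction bs) (auto simp: least_tree_def)

lemma copy_eq [simp]: "fst (copy t) = t" and copy_list_eq [simp]: "fst (copy_list ts) = ts"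
  by (induction t and ts rule: copy_copy_list.induct) auto

lemma replace_later_eq:
  "fst (replace_later x ys) =
    map (\<lambda>y. if num_leaves y = num_leaves x then x else flat (num_leaves y)) ys"
  by (induction ys) auto

lemma rev_onto_eq [simp]: "fst (rev_onto ts us) = rev ts @ us"
  by (induction ts arbitrary: us) auto

section \<open>The procedure as a recursive function\<close>

definition renew :: "tree \<Rightarrow> tree" where
  "renew v = Node (num_leaves v)
     (map least_tree (fst (next_partition (num_leaves v) (map num_leaves (children v)))))"

text \<open>The recursive form of the procedure, in which no position has to be remembered.\<close>

fun succ_tree :: "tree \<Rightarrow> tree option" and succ_forest :: "tree list \<Rightarrow> tree list option" where
  "succ_tree (Node p ts) = (case succ_forest ts of
       Some ts' \<Rightarrow> Some (Node p ts')
     | None \<Rightarrow> if fst (exhausted (Node p ts)) then None else Some (renew (Node p ts)))"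
| "succ_forest [] = None"
| "succ_forest (t # ts) = (case succ_forest ts of
       Some ts' \<Rightarrow> Some (t # ts')
     | None \<Rightarrow> map_option (\<lambda>t'. t' # fst (replace_later t' ts)) (succ_tree t))"

text \<open>The ascent undoes the descent of the search: leaving a recursive call of the successor
  function is one step of \<open>ascend\<close>. The statement is for an arbitrary position
  \<open>ctx\<close>, and \<open>ls\<close> is reversed because it lists the nearest sibling
  first.\<close>

lemma pivot_ascend_eq:
  "map_option (\<lambda>(v, ctx'). fst (ascend (renew v) ctx')) (fst (pivot ctx t)) =
     map_option (\<lambda>t'. fst (ascend t' ctx)) (succ_tree t)"
  "map_option (\<lambda>(v, ctx'). fst (ascend (renew v) ctx')) (fst (pivot_list ctx p ls ts)) =
     map_option (\<lambda>ts'. fst (ascend (Node p (rev ls @ ts')) ctx)) (succ_forest ts)"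
proof (induction ctx t and ctx p ls ts rule: pivot_pivot_list.induct)
  case (1 ctx p ts)
  then show ?case
    by (cases "fst (pivot_list ctx p [] ts)"; cases "succ_forest ts") auto
next
  case (3 ctx p ls t ts)
  then show ?case
    by (cases "fst (pivot_list ctx p (t # ls) ts)"; cases "succ_forest ts")
      (auto simp: option.map_comp o_def)
qed auto

lemma next_tree_eq: "fst (next_tree t) = succ_tree t"
proof -
  have "fst (next_tree t) = map_option (\<lambda>(v, ctx'). fst (ascend (renew v) ctx')) (fst (pivot [] t))"
    by (cases "fst (pivot [] t)") (auto simp: next_tree_def renew_def split: prod.splits)
  then show ?thesis by (simp add: pivot_ascend_eq option.map_ident)
qed

text \<open>If the tail can grow, the head stays. Otherwise the tail is greatest for its leaf
  counts, so the head must grow, by as little as possible, and the tail becomes least among the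
  tails that may be arranged after the new head. This minimum is attained entry by entry.\<close>

lemma succ_forest_is_next_Cons:
  assumes "valid_forest (t # ts)"
    and next_ts: "is_next (forests (map num_leaves ts)) (map encode) ts (succ_forest ts)"
    and next_t: "succ_forest ts = None \<Longrightarrow> is_next (trees (num_leaves t)) encode t (succ_tree t)"
  shows "is_next (forests (map num_leaves (t # ts))) (map encode) (t # ts) (succ_forest (t # ts))"
proof (cases "succ_forest ts")
  case (Some ts')
  \<comment> \<open>The first tree of a larger forest is not smaller than that of \<open>ts\<close>,
    so \<open>t\<close> may stay in front.\<close>
  have "encode t \<le> encode s" if "s \<in> set ts'" for s
  proof -
    have ts': "ts' \<in> forests (map num_leaves ts)" "map encode ts < map encode ts'"
      using next_ts Some by auto
    then obtain x xs y ys where xy: "ts = x # xs" "ts' = y # ys"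
      by (cases ts; cases ts') (auto simp: forests_def)
    then have "encode t \<le> encode x" "encode x \<le> encode y" "encode y \<le> encode s"
      using assms(1) ts' that by (auto simp: valid_forest_Cons forests_def)
    then show ?thesis by simp
  qed
  then show ?thesis
    using assms(1,2) Some by (fastforce simp: forests_def valid_forest_Cons Cons_eq_map_conv)
next
  case None
  then have max_ts: "map encode ss \<le> map encode ts" if "ss \<in> forests (map num_leaves ts)" for ss
    using next_ts that by auto
  show ?thesis
  proof (cases "succ_tree t")
    case None': None
    have "map encode ss \<le> map encode (t # ts)" if "ss \<in> forests (map num_leaves (t # ts))" for ss
    proof -
      obtain s ss' where "ss = s # ss'" "s \<in> trees (num_leaves t)" "ss' \<in> forests (map num_leaves ts)"
        using \<open>ss \<in> _\<close> by (auto simp: forests_def trees_def valid_forest_Cons map_eq_Cons_conv)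
      then show ?thesis using max_ts[of ss'] next_t[OF None] None' by auto
    qed
    then show ?thesis using None None' by auto
  next
    case (Some t')
    have t': "valid t'" "num_leaves t' = num_leaves t" "encode t < encode t'"
      and t'_least: "\<And>s. \<lbrakk>s \<in> trees (num_leaves t); encode t < encode s\<rbrakk> \<Longrightarrow> encode t' \<le> encode s"
      using next_t[OF None] Some by (auto simp: trees_def)
    define us where "us = map (\<lambda>y. if num_leaves y = num_leaves t' then t' else flat (num_leaves y)) ts"
    have ge: "num_leaves t \<le> num_leaves y" "valid y" "0 < num_leaves y" if "y \<in> set ts" for y
      using that assms(1) num_leaves_mono num_leaves_pos
      by (auto simp: valid_forest_Cons) (auto simp: valid_forest_def)
    have valid_us: "valid u \<and> encode t' \<le> encode u" if "u \<in> set us" for u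
    proof -
      obtain y where y: "y \<in> set ts" "u = (if num_leaves y = num_leaves t' then t' else flat (num_leaves y))"
        using \<open>u \<in> set us\<close> unfolding us_def set_map by blast
      show ?thesis
      proof (cases "num_leaves y = num_leaves t'")
        case False
        \<comment> \<open>A sibling that does not become a copy has more leaves than
          \<open>t'\<close>, hence at least two, and its star is a valid tree.\<close>
        then have "num_leaves t' < num_leaves y" using ge[OF y(1)] t' by simp
        then show ?thesis
          using y False valid_least_tree[of "num_leaves y"] ge[OF y(1)] num_leaves_pos[OF t'(1)]
            encode_less_if_num_leaves_less[of t' "flat (num_leaves y)"]
          by (auto simp: least_tree_def flat_def)
      qed (use y t' in auto)
    qed
    have nl: "map num_leaves us = map num_leaves ts"
      by (auto simp: us_def flat_def)
    have least_us: "list_all2 (\<lambda>u s. encode u \<le> encode s) us ss"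
      if ss: "map num_leaves ss = map num_leaves ts" "\<forall>s\<in>set ss. valid s \<and> encode t' \<le> encode s" for ss
      unfolding list_all2_conv_all_nth
    proof (intro conjI allI impI)
      show "length us = length ss" using arg_cong[OF ss(1), of length] by (simp add: us_def)
      fix i assume i: "i < length us"
      then have i': "i < length ss" "i < length ts" using \<open>length us = length ss\<close> by (auto simp: us_def)
      have l: "num_leaves (ss ! i) = num_leaves (ts ! i)"
        using ss(1) i' by (metis nth_map)
      show "encode (us ! i) \<le> encode (ss ! i)"
      proof (cases "num_leaves (ts ! i) = num_leaves t'")
        case True
        then show ?thesis using ss(2) i' by (simp add: us_def)
      next
        case False
        have "num_leaves (ts ! i) \<noteq> 1"
          using ge[of "ts ! i"] i' t' False num_leaves_pos[OF t'(1)] by auto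
        then show ?thesis
          using False i' l ss(2) least_tree_le[of "ss ! i" "num_leaves (ts ! i)"]
          by (simp add: us_def least_tree_def trees_def)
      qed
    qed
    have sorted_us: "valid_forest us"
    proof -
      have "sorted (map encode us)"
        unfolding sorted_iff_nth_mono
      proof (intro allI impI)
        fix i j assume ij: "i \<le> j" "j < length (map encode us)"
        then have ij': "i < length ts" "j < length ts" by (auto simp: us_def)
        then have le: "num_leaves (ts ! i) \<le> num_leaves (ts ! j)"
          using assms(1) ij by (intro num_leaves_mono) (auto simp: valid_forest_def sorted_iff_nth_mono nth_Cons' split: if_splits)
        \<comment> \<open>Equal leaf counts give equal trees; a copy of \<open>t'\<close> lies below
          everything in \<open>us\<close>; in the remaining case the leaf counts increase
          strictly.\<close>
        show "map encode us ! i \<le> map encode us ! j"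
        proof (cases "num_leaves (ts ! i) = num_leaves (ts ! j) \<or> num_leaves (ts ! i) = num_leaves t'")
          case True
          moreover have "us ! j \<in> set us" using ij by simp
          ultimately show ?thesis using ij ij' valid_us[of "us ! j"] by (auto simp: us_def)
        next
          case False
          then have "num_leaves (us ! i) < num_leaves (us ! j)"
            using le ij' nl by (metis le_neq_implies_less length_map nth_map)
          then show ?thesis using ij ij' encode_less_if_num_leaves_less[of "us ! i" "us ! j"]
            by (auto simp: us_def)
        qed
      qed
      then show ?thesis using valid_us by (simp add: valid_forest_def)
    qed
    have "map encode (t' # us) \<le> map encode ss"
      if ss: "ss \<in> forests (map num_leaves (t # ts))" "map encode (t # ts) < map encode ss" for ss
    proof -
      obtain s ss' where s: "ss = s # ss'" "s \<in> trees (num_leaves t)" "ss' \<in> forests (map num_leaves ts)"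
        "\<forall>x\<in>set ss'. encode s \<le> encode x"
        using ss(1) by (auto simp: forests_def trees_def valid_forest_Cons map_eq_Cons_conv)
      \<comment> \<open>With head \<open>t\<close> the tail would have to exceed \<open>ts\<close>,
        which is greatest.\<close>
      then have "encode t < encode s" using ss(2) max_ts[of ss'] by auto
      then have "encode t' \<le> encode s" using s t'_least by blast
      moreover have "map encode us \<le> map encode ss'" if "encode t' = encode s"
        using s that by (intro map_encode_mono least_us) (auto simp: forests_def valid_forest_def)
      ultimately show ?thesis using s(1) by auto
    qed
    moreover have "t' # us \<in> forests (map num_leaves (t # ts))"
      using t' valid_us sorted_us nl by (auto simp: forests_def valid_forest_Cons)
    ultimately show ?thesis
      using None Some t' by (simp add: replace_later_eq us_def)
  qed
qed

text \<open>Since the children are greatest for the present partition, every larger tree induces a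
  larger partition. The least such tree has the next partition and, under it, least trees at all
  children.\<close>

lemma renew_is_next:
  assumes "valid (Node p ts)" "2 \<le> p" "map num_leaves ts \<noteq> max_partition p"
    and max_ts: "is_next (forests (map num_leaves ts)) (map encode) ts None"
  shows "is_next (trees p) encode (Node p ts) (Some (renew (Node p ts)))"
proof -
  define bs where "bs = fst (next_partition p (map num_leaves ts))"
  have v: "valid_forest ts" "map num_leaves ts \<in> proper_partitions p" "Node p ts \<in> trees p"
    using assms by (auto simp: valid_Node_iff trees_def)
  then have bs: "bs \<in> proper_partitions p" "map num_leaves ts < bs"
    "\<And>cs. \<lbrakk>cs \<in> proper_partitions p; map num_leaves ts < cs\<rbrakk> \<Longrightarrow> bs \<le> cs"
    using next_partition_is_next[of "map num_leaves ts" p] assms(3) by (auto simp: bs_def)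
  have r: "renew (Node p ts) = Node p (map least_tree bs)"
    by (simp add: renew_def bs_def)
  have pos: "0 < b" if "b \<in> set bs" for b
    using that bs(1) by (auto simp: proper_partitions_def partitions_def intro: gr0I)
  have nl: "map num_leaves (map least_tree bs) = bs"
    by (simp add: o_def)
  have "sorted (map encode (map least_tree bs))"
  proof -
    have "encode (least_tree a) \<le> encode (least_tree b)" if "a \<le> b" for a b
      using that encode_less_if_num_leaves_less[of "least_tree a" "least_tree b"]
      by (cases "a = b") auto
    then show ?thesis
      using bs(1) by (auto simp: proper_partitions_def partitions_def sorted_iff_nth_mono)
  qed
  then have mem: "Node p (map least_tree bs) \<in> trees p"
    using assms(2) bs(1) pos valid_least_tree by (simp only: Node_in_trees_iff nl) (auto simp: valid_forest_def)
  have "encode (Node p (map least_tree bs)) \<le> encode s"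
    if s: "s \<in> trees p" "encode (Node p ts) < encode s" for s
  proof -
    obtain ss where ss: "s = Node p ss" "valid_forest ss" "map num_leaves ss \<in> proper_partitions p"
      using s(1) assms(2) by (rule trees_casesE)
    have "\<not> map encode ts < map encode ss" if "map num_leaves ts = map num_leaves ss"
      using max_ts ss(2) that by (auto simp: forests_def not_less)
    then have "map num_leaves ts < map num_leaves ss"
      using encode_Node_less_iff[of p ts ss] s v ss(1) assms(2) by auto
    then have "bs \<le> map num_leaves ss" using bs(3) ss by blast
    moreover have "map encode (map least_tree bs) \<le> map encode ss" if "bs = map num_leaves ss"
      using ss(2) by (intro map_encode_mono)
        (auto simp: that list_all2_conv_all_nth valid_forest_def trees_def intro!: least_tree_le)
    ultimately have "\<not> encode s < encode (Node p (map least_tree bs))"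
      using encode_Node_less_iff[of p ss "map least_tree bs"] s(1) mem ss(1) assms(2)
      unfolding nl by (auto simp del: encode.simps map_map)
    then show ?thesis by simp
  qed
  then show ?thesis
    using mem r encode_Node_less_iff[of p ts "map least_tree bs"] v(3) assms(2) bs(2) nl
    by simp
qed

lemma succ_tree_is_next: "valid t \<Longrightarrow> is_next (trees (num_leaves t)) encode t (succ_tree t)"
  and succ_forest_is_next:
    "valid_forest ts \<Longrightarrow> is_next (forests (map num_leaves ts)) (map encode) ts (succ_forest ts)"
proof (induction t and ts rule: succ_tree_succ_forest.induct)
  case (1 p ts)
  show ?case
  proof (cases "p = 1")
    case True
    then have "Node p ts \<in> trees 1" using "1.prems" by (simp add: trees_def)
    then have "ts = []" unfolding trees_1 by simp
    then show ?thesis using True trees_1 by simp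
  next
    case False
    then have v: "valid_forest ts" "map num_leaves ts \<in> proper_partitions p"
      using "1.prems" by (auto simp: valid_Node_iff)
    have p: "2 \<le> p" "ts \<noteq> []"
      using v(2) by (blast intro: proper_partitions_ge_2, auto simp: proper_partitions_def)
    have mem: "Node p ts \<in> trees p" using "1.prems" by (simp add: trees_def)
    have next_ts: "is_next (forests (map num_leaves ts)) (map encode) ts (succ_forest ts)"
      using "1.IH" v(1) by blast
    show ?thesis
    proof (cases "succ_forest ts")
      case None
      \<comment> \<open>Here neither the partition nor, for this partition, the list of children can
        grow.\<close>
      have "encode s \<le> encode (Node p ts)"
        if s: "s \<in> trees p" and max: "map num_leaves ts = max_partition p" for s
      proof -
        obtain ss where ss: "s = Node p ss" "valid_forest ss" "map num_leaves ss \<in> proper_partitions p"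
          using s p(1) by (rule trees_casesE)
        have "map num_leaves ss \<le> map num_leaves ts"
          using max_partition_greatest ss(3) max by (auto simp: proper_partitions_def)
        moreover have "map encode ss \<le> map encode ts" if "map num_leaves ss = map num_leaves ts"
          using next_ts None ss(2) that by (auto simp: forests_def)
        ultimately have "\<not> encode (Node p ts) < encode s"
          using encode_Node_less_iff[of p ts ss] mem s ss(1) p(1) by (auto simp del: encode.simps)
        then show ?thesis by simp
      qed
      then show ?thesis
        using None next_ts renew_is_next[of p ts] "1.prems" p by (auto simp del: encode.simps)
    next
      case (Some ts')
      have ts': "valid_forest ts'" "map num_leaves ts' = map num_leaves ts"
        "map encode ts < map encode ts'"
        and least: "\<And>ss. \<lbrakk>ss \<in> forests (map num_leaves ts); map encode ts < map encode ss\<rbrakk>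
          \<Longrightarrow> map encode ts' \<le> map encode ss"
        using next_ts Some by (auto simp: forests_def)
      have mem': "Node p ts' \<in> trees p" using ts' v p by (simp add: Node_in_trees_iff)
      have "encode (Node p ts') \<le> encode s" if s: "s \<in> trees p" "encode (Node p ts) < encode s" for s
      proof -
        obtain ss where ss: "s = Node p ss" "valid_forest ss" "map num_leaves ss \<in> proper_partitions p"
          using s(1) p(1) by (rule trees_casesE)
        have "map encode ts' \<le> map encode ss"
          if "map num_leaves ss = map num_leaves ts" "map encode ts < map encode ss"
          using least that ss(2) by (simp add: forests_def)
        moreover have "map num_leaves ts < map num_leaves ss \<or>
            map num_leaves ts = map num_leaves ss \<and> map encode ts < map encode ss"
          using encode_Node_less_iff[of p ts ss] mem s p(1) unfolding ss(1) by blast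
        ultimately have "\<not> (map num_leaves ss < map num_leaves ts \<or>
            map num_leaves ss = map num_leaves ts \<and> map encode ss < map encode ts')"
          by (metis not_less order_less_asym)
        then have "\<not> encode s < encode (Node p ts')"
          using encode_Node_less_iff[of p ss ts'] mem' s(1) p(1) ts'(2) unfolding ss(1) by metis
        then show ?thesis by simp
      qed
      then show ?thesis
        using Some mem mem' encode_Node_less_iff[of p ts ts'] p(1) ts' by simp
    qed
  qed
next
  case 2
  then show ?case by (simp add: forests_def)
next
  case (3 t ts)
  show ?case
  proof (rule succ_forest_is_next_Cons)
    show "valid_forest (t # ts)" by fact
  qed (use 3 valid_forest_Cons in blast)+
qed

section \<open>The sequence of generated trees\<close>

definition gen_tree :: "nat \<Rightarrow> nat \<Rightarrow> tree option" where
  "gen_tree n i = fst (generation n i)"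

lemma gen_tree_0: "2 \<le> n \<Longrightarrow> gen_tree n 0 = Some (least_tree n)"
  by (simp add: gen_tree_def least_tree_def)

lemma gen_tree_Suc: "gen_tree n (Suc i) = Option.bind (gen_tree n i) succ_tree"
  by (auto simp: gen_tree_def next_tree_eq split: prod.splits option.splits)

lemma gen_tree_in_trees: "\<lbrakk>2 \<le> n; gen_tree n i = Some t\<rbrakk> \<Longrightarrow> t \<in> trees n"
proof (induction i arbitrary: t)
  case 0
  then show ?case using valid_least_tree[of n] by (auto simp: gen_tree_0 trees_def)
next
  case (Suc i)
  then obtain s where s: "gen_tree n i = Some s" "succ_tree s = Some t"
    by (auto simp: gen_tree_Suc bind_eq_Some_conv)
  then have "valid s" "num_leaves s = n" using Suc by (auto simp: trees_def)
  then show ?case using succ_tree_is_next[of s] s by simp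
qed

lemma gen_tree_less:
  assumes "2 \<le> n" "gen_tree n j = Some t" "i < j"
  shows "\<exists>s. gen_tree n i = Some s \<and> encode s < encode t"
  using assms(2,3)
proof (induction j arbitrary: t)
  case (Suc j)
  then obtain s where s: "gen_tree n j = Some s" "succ_tree s = Some t"
    by (auto simp: gen_tree_Suc bind_eq_Some_conv)
  have "valid s" using gen_tree_in_trees[OF assms(1) s(1)] by (simp add: trees_def)
  then have "encode s < encode t" using succ_tree_is_next[of s] s by simp
  then show ?case using Suc.IH[OF s(1)] s(1) Suc.prems by (cases "i = j") (auto intro: less_trans)
qed simp

lemma gen_tree_inject:
  "\<lbrakk>2 \<le> n; gen_tree n i = Some t; gen_tree n j = Some t\<rbrakk> \<Longrightarrow> i = j"
  using gen_tree_less[of n i t j] gen_tree_less[of n j t i] by (cases i j rule: linorder_cases) auto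

text \<open>A missed tree \<open>s\<close> would keep the run below it forever: a tree below
  \<open>s\<close> is not greatest, and its immediate successor cannot jump over \<open>s\<close>.
  The infinitely many distinct trees obtained contradict finiteness.\<close>

lemma gen_tree_surj:
  assumes "2 \<le> n" "s \<in> trees n"
  shows "\<exists>i. gen_tree n i = Some s"
proof (rule ccontr)
  assume *: "\<nexists>i. gen_tree n i = Some s"
  have below: "\<exists>t. gen_tree n i = Some t \<and> encode t < encode s" for i
  proof (induction i)
    case 0
    have "valid s" "valid (least_tree n)" "least_tree n \<noteq> s"
      using assms valid_least_tree[of n] * gen_tree_0[of n] by (auto simp: trees_def)
    then show ?case
      using least_tree_le[OF assms(2)] gen_tree_0[OF assms(1)] encode_inject by fastforce
  next
    case (Suc i)
    then obtain t where t: "gen_tree n i = Some t" "encode t < encode s" by blast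
    have tn: "valid t" "num_leaves t = n"
      using gen_tree_in_trees[OF assms(1) t(1)] by (auto simp: trees_def)
    then have next_t: "is_next (trees n) encode t (succ_tree t)" using succ_tree_is_next by blast
    then obtain t' where t': "succ_tree t = Some t'"
      using t(2) assms(2) by (cases "succ_tree t") auto
    then have "encode t' \<le> encode s" "t' \<in> trees n" using next_t t assms(2) by auto
    moreover have "gen_tree n (Suc i) = Some t'" using t t' by (simp add: gen_tree_Suc)
    moreover from this have "t' \<noteq> s" using * by blast
    ultimately show ?case using assms(2) encode_inject[of t' s] by (auto simp: trees_def)
  qed
  have "inj (gen_tree n)"
    using below gen_tree_inject[OF assms(1)] by (metis injI)
  moreover have "range (gen_tree n) \<subseteq> Some ` trees n"
    using below gen_tree_in_trees[OF assms(1)] by (force simp: image_iff)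
  ultimately have "finite (UNIV :: nat set)"
    using finite_trees by (meson finite_imageI finite_subset finite_imageD)
  then show False by simp
qed

section \<open>Running time\<close>

fun num_nodes :: "tree \<Rightarrow> nat" where
  "num_nodes (Node p ts) = Suc (sum_list (map num_nodes ts))"

text \<open>
  The constant 3 instead of 2 accommodates a star with a single leaf, so that no order on the
  leaf counts of the siblings has to be tracked along an ascent.
\<close>

definition small :: "tree \<Rightarrow> bool" where
  "small t \<longleftrightarrow> num_nodes t + 1 \<le> 3 * num_leaves t"

text \<open>The \<open>+ 1\<close> in \<open>small\<close>, summed over at least two children, pays
  for the parent and for the parent's own \<open>+ 1\<close>.\<close>

lemma small_Node:
  assumes "\<forall>t\<in>set ts. small t" "2 \<le> length ts" "p = sum_list (map num_leaves ts)"
  shows "small (Node p ts)"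
proof -
  have "sum_list (map num_nodes us) + length us \<le> 3 * sum_list (map num_leaves us)"
    if "\<forall>t\<in>set us. small t" for us
    using that by (induction us) (auto simp: small_def)
  then show ?thesis using assms by (fastforce simp: small_def)
qed

lemma small_leaf [simp]: "small (Node (Suc 0) [])"
  by (simp add: small_def)

lemma small_flat: "0 < p \<Longrightarrow> small (flat p)"
  by (simp add: small_def flat_def sum_list_replicate)

lemma small_least_tree: "0 < p \<Longrightarrow> small (least_tree p)"
  by (simp add: least_tree_def small_flat)

lemma valid_imp_small: "valid t \<Longrightarrow> small t"
proof (induction t)
  case (Node p ts)
  then show ?case
    by (cases "ts = []") (auto simp: valid.simps intro!: small_Node)
qed

lemma length_le_sum_leaves:
  "\<forall>t\<in>set ts. valid t \<Longrightarrow> length ts \<le> sum_list (map num_leaves ts)"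
  by (induction ts) (auto dest: num_leaves_pos)

lemma length_le_sum_list: "0 \<notin> set as \<Longrightarrow> length as \<le> sum_list as"
  by (induction as) auto

section \<open>Step counts of the procedures\<close>

lemma time_mk_leaves: "snd (mk_leaves k) = k + 1"
  by (induction k) auto

lemma time_star: "snd (star p) = p + 2"
  by (simp add: star_def time_mk_leaves)

lemma time_induced_partition: "snd (induced_partition ts) = length ts + 1"
  by (induction ts) auto

lemma time_exhausted: "snd (exhausted v) \<le> length (children v) + 2"
  by (simp add: exhausted_def time_induced_partition)

text \<open>The test for exhaustion reads the whole list of children, so the bound for lists keeps
  \<open>length ts\<close> steps in reserve. The \<open>+ 2\<close> at a single node pays for its
  list cell and its share of that reserve.\<close>

lemma time_pivot: "snd (pivot ctx t) + 2 \<le> 6 * num_nodes t"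
  and time_pivot_list: "snd (pivot_list ctx p ls ts) + length ts \<le> 1 + 6 * sum_list (map num_nodes ts)"
proof (induction ctx t and ctx p ls ts rule: pivot_pivot_list.induct)
  case (1 ctx p ts)
  then show ?case using time_exhausted[of "Node p ts"] by (auto split: option.split)
next
  case (3 ctx p ls t ts)
  then show ?case by (auto split: option.split)
qed auto

text \<open>Three steps per node: its own call, its list cell, and the empty end of its list of
  children. The root has no list cell.\<close>

lemma time_copy: "snd (copy t) + 1 \<le> 3 * num_nodes t"
  and time_copy_list: "snd (copy_list ts) \<le> 1 + 3 * sum_list (map num_nodes ts)"
  by (induction t and ts rule: copy_copy_list.induct) auto

lemma time_write_cotree: "snd (write_cotree b t) + 1 \<le> 3 * num_nodes t"
  and time_write_cotree_list:
    "snd (write_cotree_list b ts) \<le> 1 + 3 * sum_list (map num_nodes ts)"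
  by (induction b t and b ts rule: write_cotree_write_cotree_list.induct) auto

lemma time_prepend_copies: "snd (prepend_copies q c as) = q + 1"
  by (induction q) auto

lemma time_next_partition_end: "snd (next_partition_end as) \<le> length as + sum_list as + 2"
proof (induction as rule: next_partition_end.induct)
  case (3 x y)
  have "(y - 1) div (x + 1) \<le> y - 1" by (rule div_le_dividend)
  then have "(y - 1) div (x + 1) \<le> x + y" by linarith
  then show ?case by (auto simp: Let_def time_prepend_copies)
qed auto

lemma time_next_partition: "snd (next_partition p as) \<le> length as + sum_list as + 3"
  using time_next_partition_end[of as] by (simp add: next_partition_def)

lemma time_mk_children: "snd (mk_children bs) \<le> 1 + 3 * length bs + sum_list bs"
  by (induction bs) (auto simp: time_star)

text \<open>A copy of \<open>x\<close> replaces only a sibling with as many leaves as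
  \<open>x\<close>, so its cost, below 9 steps per leaf, can be charged to that sibling; the tenth
  step covers the call itself.\<close>

lemma time_replace_later:
  assumes "small x" "\<forall>y\<in>set ys. valid y"
  shows "snd (replace_later x ys) \<le> 1 + 10 * sum_list (map num_leaves ys)"
  using assms(2)
proof (induction ys)
  case (Cons y ys)
  then show ?case
    using time_copy[of x] assms(1) num_leaves_pos[of y] by (auto simp: time_star small_def)
qed simp

lemma time_rev_onto: "snd (rev_onto ts us) = length ts + 1"
  by (induction ts arbitrary: us) auto

text \<open>\<open>consistent l ctx n\<close>: a node with \<open>l\<close> leaves at position \<open>ctx\<close> belongs to a tree with \<open>n\<close> leaves.\<close>

fun consistent :: "nat \<Rightarrow> ancestry \<Rightarrow> nat \<Rightarrow> bool" where
  "consistent l [] n \<longleftrightarrow> l = n"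
| "consistent l ((p, ls, rs) # ctx) n \<longleftrightarrow>
     p = l + sum_list (map num_leaves ls) + sum_list (map num_leaves rs) \<and> ls @ rs \<noteq> [] \<and>
     (\<forall>t\<in>set (ls @ rs). valid t) \<and> consistent p ctx n"

text \<open>The siblings off the path are untouched subtrees of the input, and inner nodes have at
  least two children, so each level of the path has a sibling to which costs can be charged.\<close>

lemma pivot_consistent:
  "\<lbrakk>fst (pivot ctx t) = Some (v, ctx'); valid t; consistent (num_leaves t) ctx n\<rbrakk>
    \<Longrightarrow> valid v \<and> \<not> fst (exhausted v) \<and> consistent (num_leaves v) ctx' n"
  "\<lbrakk>fst (pivot_list ctx p ls ts) = Some (v, ctx'); \<forall>t\<in>set (ls @ ts). valid t; 2 \<le> length (ls @ ts);
    p = sum_list (map num_leaves (ls @ ts)); consistent p ctx n\<rbrakk>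
    \<Longrightarrow> valid v \<and> \<not> fst (exhausted v) \<and> consistent (num_leaves v) ctx' n"
proof (induction ctx t and ctx p ls ts rule: pivot_pivot_list.induct)
  case (1 ctx p ts)
  show ?case
  proof (cases "fst (pivot_list ctx p [] ts)")
    case None
    then show ?thesis using 1(2-) by (auto split: if_splits)
  next
    case (Some z)
    then have "ts \<noteq> []" by auto
    then show ?thesis using 1 Some by (simp add: valid.simps)
  qed
next
  case (3 ctx p ls t ts)
  show ?case
  proof (cases "fst (pivot_list ctx p (t # ls) ts)")
    case None
    have "consistent (num_leaves t) ((p, ls, ts) # ctx) n"
      using "3.prems" by auto
    then show ?thesis using 3 None by simp
  next
    case (Some z)
    then show ?thesis using 3 by simp
  qed
qed simp

lemma consistent_le: "consistent l ctx n \<Longrightarrow> l \<le> n"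
  by (induction l ctx n rule: consistent.induct) auto

text \<open>With \<open>L\<close> and \<open>R\<close> leaves below the earlier and later siblings,
  a level costs at most \<open>3 + 10 * R + L\<close>. As \<open>L + R\<close> is at least 1, this
  is at most 13 steps for each leaf gained by passing to the parent, and the sum telescopes.\<close>

lemma time_ascend:
  "\<lbrakk>small x; consistent (num_leaves x) ctx n\<rbrakk> \<Longrightarrow> snd (ascend x ctx) + 13 * num_leaves x \<le> 1 + 13 * n"
proof (induction x ctx rule: ascend.induct)
  case (2 x p ls rs ctx)
  define us where "us = fst (replace_later x rs)"
  have v: "\<forall>t\<in>set (ls @ rs). valid t" "ls @ rs \<noteq> []"
    "p = num_leaves x + sum_list (map num_leaves ls) + sum_list (map num_leaves rs)" "consistent p ctx n"
    using 2 by auto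
  have us: "map num_leaves us = map num_leaves rs" "length us = length rs"
    by (auto simp: us_def replace_later_eq flat_def)
  have "small u" if "u \<in> set us" for u
    using that v(1) "2.prems"(1) num_leaves_pos small_flat by (auto simp: us_def replace_later_eq)
  then have "small (Node p (rev ls @ x # us))"
    using v valid_imp_small "2.prems"(1) us
    by (intro small_Node) (auto simp: rev_map[symmetric] neq_Nil_conv)
  then have "snd (ascend (Node p (rev ls @ x # us)) ctx) + 13 * p \<le> 1 + 13 * n"
    using "2.IH"[of "rev ls @ x # us"] v(4) by (simp add: us_def)
  moreover have "snd (replace_later x rs) \<le> 1 + 10 * sum_list (map num_leaves rs)"
    using time_replace_later "2.prems"(1) v(1) by simp
  moreover have "length ls \<le> sum_list (map num_leaves ls)" "length rs \<le> sum_list (map num_leaves rs)"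
    using v(1) by (intro length_le_sum_leaves; simp)+
  moreover have "0 < length ls + length rs" using v(2) by simp
  moreover have "snd (ascend x ((p, ls, rs) # ctx)) =
      snd (replace_later x rs) + length ls + 2 + snd (ascend (Node p (rev ls @ x # us)) ctx)"
    by (simp add: time_rev_onto us_def)
  ultimately show ?case using v(3) by linarith
qed simp

lemma time_next_tree:
  assumes "t \<in> trees n"
  shows "snd (next_tree t) \<le> 45 * n"
proof -
  have v: "valid t" "num_leaves t = n" using assms by (auto simp: trees_def)
  have n: "0 < n" using num_leaves_pos v by blast
  have pivot: "snd (pivot [] t) \<le> 18 * n"
    using time_pivot[of "[]" t] valid_imp_small[OF v(1)] v(2) by (simp add: small_def)
  show ?thesis
  proof (cases "fst (pivot [] t)")
    case None
    then show ?thesis using pivot n by (simp add: next_tree_def)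
  next
    case (Some z)
    obtain w ctx where z: "z = (w, ctx)" by fastforce
    then have w: "valid w" "\<not> fst (exhausted w)" "consistent (num_leaves w) ctx n"
      using pivot_consistent(1)[of "[]" t w ctx n] Some v by auto
    define as where "as = map num_leaves (children w)"
    define bs where "bs = fst (next_partition (num_leaves w) as)"
    have as: "as \<in> proper_partitions (num_leaves w)" "as \<noteq> max_partition (num_leaves w)"
      using w by (cases w; auto simp: valid_Node_iff as_def)+
    then have bs: "bs \<in> proper_partitions (num_leaves w)"
      using next_partition_is_next[of as "num_leaves w"] by (simp add: bs_def)
    have pos: "0 < b" if "b \<in> set bs" for b
      using that bs by (auto simp: proper_partitions_def partitions_def intro: gr0I)
    have "small (Node (num_leaves w) (map least_tree bs))"
      using bs pos small_least_tree
      by (intro small_Node) (auto simp: proper_partitions_def partitions_def o_def)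
    then have asc: "snd (ascend (Node (num_leaves w) (map least_tree bs)) ctx) \<le> 1 + 13 * n"
      using time_ascend[of "Node (num_leaves w) (map least_tree bs)" ctx n] w(3) by simp
    have le: "num_leaves w \<le> n" using w(3) by (rule consistent_le)
    have "length as \<le> n" "sum_list as \<le> n" "length bs \<le> n" "sum_list bs \<le> n"
      using as(1) bs le length_le_sum_list[of as] length_le_sum_list[of bs]
      by (auto simp: proper_partitions_def partitions_def)
    moreover have "snd (next_tree t) = Suc (snd (pivot [] t) + (length as + 1 +
        (snd (next_partition (num_leaves w) as) + (snd (mk_children bs) +
        snd (ascend (Node (num_leaves w) (map least_tree bs)) ctx)))))"
      using Some z by (simp add: next_tree_def time_induced_partition as_def bs_def)
    \<comment> \<open>Search \<open>18 * n\<close>, reading the partition \<open>n\<close>, its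
      successor \<open>2 * n\<close>, the new children \<open>4 * n\<close> and the ascent
      \<open>13 * n\<close> add up to at most \<open>38 * n + 7\<close>.\<close>
    ultimately show ?thesis
      using pivot asc n time_next_partition[of "num_leaves w" as] time_mk_children[of bs]
      by linarith
  qed
qed

section \<open>Times of the outputs\<close>

definition cotree_of :: "bool \<Rightarrow> tree \<Rightarrow> cotree" where
  "cotree_of b t = fst (write_cotree b t)"

lemma nth_output_Some_iff:
  "nth_output n k = Some (c, s) \<longleftrightarrow> (\<exists>t r. generation n (k div 2) = (Some t, r) \<and>
     c = cotree_of (odd k) t \<and>
     s = r + 1 + snd (write_cotree False t) + (if odd k then snd (write_cotree True t) else 0))"
proof -
  have eq: "x = (c, s) \<longleftrightarrow> c = fst x \<and> s = snd x" for x :: "cotree \<times> nat" by auto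
  show ?thesis
    by (auto simp: nth_output_def cotree_of_def eq split: prod.splits option.splits)
qed

lemma time_write_cotree_trees: "t \<in> trees n \<Longrightarrow> snd (write_cotree b t) \<le> 9 * n"
  using time_write_cotree[of b t] valid_imp_small[of t] by (auto simp: trees_def small_def)

text \<open>From label 0 to label 1 of the same tree, one cotree is written. From one tree to the
  next, there is a call of \<open>next_tree\<close> and one cotree to write: at most
  \<open>45 * n + 9 * n + 1\<close> steps.\<close>

lemma delay_linear:
  assumes "2 \<le> n" "nth_output n k = Some (c, s)" "nth_output n (Suc k) = Some (d, s')"
  shows "s' \<le> s + 60 * n"
proof -
  obtain t r where t: "generation n (k div 2) = (Some t, r)"
    "s = r + 1 + snd (write_cotree False t) + (if odd k then snd (write_cotree True t) else 0)"
    using assms(2) nth_output_Some_iff by blast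
  obtain t' r' where t': "generation n (Suc k div 2) = (Some t', r')"
    "s' = r' + 1 + snd (write_cotree False t') + (if odd (Suc k) then snd (write_cotree True t') else 0)"
    using assms(3) nth_output_Some_iff by blast
  have tn: "t \<in> trees n" "t' \<in> trees n"
    using gen_tree_in_trees[OF assms(1)] t(1) t'(1) by (metis fst_conv gen_tree_def)+
  show ?thesis
  proof (cases "even k")
    case True
    then have "t' = t" "r' = r" using t(1) t'(1) by auto
    then show ?thesis using t(2) t'(2) True time_write_cotree_trees[OF tn(1), of True] by simp
  next
    case False
    then have "Suc k div 2 = Suc (k div 2)" by simp
    then have "r' = snd (generation n (Suc (k div 2)))" using t'(1) by (metis snd_conv)
    also have "\<dots> = r + 1 + snd (write_cotree False t) + snd (write_cotree True t) + snd (next_tree t)"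
      using t(1) by simp
    finally show ?thesis
      using t(2) t'(2) False time_write_cotree_trees[OF tn(2), of False] time_next_tree[OF tn(1)] assms(1)
      by simp
  qed
qed

lemma first_output_linear: "2 \<le> n \<Longrightarrow> \<exists>c s. nth_output n 0 = Some (c, s) \<and> s \<le> 20 * n"
proof -
  assume n: "2 \<le> n"
  have "generation n 0 = (Some (flat n), n + 3)"
    by (simp add: prod_eq_iff time_star)
  moreover have "flat n \<in> trees n"
    using valid_least_tree[of n] n by (auto simp: trees_def least_tree_def flat_def)
  ultimately show ?thesis
    using n time_write_cotree_trees[of "flat n" n False] by (fastforce simp: nth_output_Some_iff)
qed

section \<open>Cotrees\<close>

lemma write_cotree_list_eq: "fst (write_cotree_list b ts) = map (cotree_of b) ts"
  by (induction ts) (auto simp: cotree_of_def)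

lemma cotree_of_Node [simp]:
  "cotree_of b (Node p ts) = (if ts = [] then CLeaf else CNode b (map (cotree_of (\<not> b)) ts))"
  by (simp add: cotree_of_def write_cotree_list_eq)

lemma root_label_cotree_of:
  "root_label (cotree_of b t) = (if children t = [] then None else Some b)"
  by (cases t) simp

lemma is_cotree_cotree_of: "valid t \<Longrightarrow> is_cotree (cotree_of b t)"
proof (induction t arbitrary: b)
  case (Node p ts)
  then show ?case by (auto simp: valid.simps root_label_cotree_of)
qed

section \<open>Addresses of leaves and nodes\<close>

lemma leaves_CLeaf [simp]: "leaves CLeaf = {[]}"
proof -
  have "subtree_at CLeaf p = Some CLeaf \<longleftrightarrow> p = []" for p by (cases p) auto
  then show ?thesis by (auto simp: leaves_def)
qed

lemma Nil_notin_leaves_CNode [simp]: "[] \<notin> leaves (CNode b ts)"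
  by (simp add: leaves_def)

lemma Cons_in_leaves_CNode [simp]:
  "i # p \<in> leaves (CNode b ts) \<longleftrightarrow> i < length ts \<and> p \<in> leaves (ts ! i)"
  by (simp add: leaves_def)

lemma leaves_CNode: "leaves (CNode b ts) = (\<Union>i<length ts. (#) i ` leaves (ts ! i))"
proof (rule set_eqI)
  fix p
  show "p \<in> leaves (CNode b ts) \<longleftrightarrow> p \<in> (\<Union>i<length ts. (#) i ` leaves (ts ! i))"
    by (cases p) auto
qed

lemma Nil_in_nodes [simp]: "[] \<in> nodes t"
  by (simp add: nodes_def)

lemma Cons_in_nodes_CNode [simp]:
  "i # p \<in> nodes (CNode b ts) \<longleftrightarrow> i < length ts \<and> p \<in> nodes (ts ! i)"
  by (simp add: nodes_def)

lemma nodes_CLeaf [simp]: "nodes CLeaf = {[]}"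
proof -
  have "subtree_at CLeaf p \<noteq> None \<longleftrightarrow> p = []" for p by (cases p) auto
  then show ?thesis by (auto simp: nodes_def)
qed

lemma label_at_Nil [simp]: "label_at t [] = root_label t"
  by (simp add: label_at_def)

lemma label_at_Cons [simp]: "i < length ts \<Longrightarrow> label_at (CNode b ts) (i # p) = label_at (ts ! i) p"
  by (simp add: label_at_def)

lemma root_label_None_iff: "root_label s = None \<longleftrightarrow> s = CLeaf"
  by (cases s) auto

text \<open>Leaves are recognized by their missing label, so a label-preserving bijection of the
  nodes maps leaves to leaves.\<close>

lemma leaves_eq_unlabelled_nodes: "leaves t = {p \<in> nodes t. label_at t p = None}"
  by (auto simp: leaves_def nodes_def label_at_def root_label_None_iff)

lemma cotree_iso_card_leaves:
  assumes "cotree_iso t s"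
  shows "card (leaves t) = card (leaves s)"
proof -
  obtain f where f: "bij_betw f (nodes t) (nodes s)" "\<forall>p\<in>nodes t. label_at s (f p) = label_at t p"
    using assms by (auto simp: cotree_iso_def)
  have "f ` leaves t = leaves s"
    unfolding leaves_eq_unlabelled_nodes bij_betw_imp_surj_on[OF f(1), symmetric]
    using f(2) by auto
  moreover have "inj_on f (leaves t)"
    using f(1) by (auto simp: leaves_eq_unlabelled_nodes bij_betw_def intro: inj_on_subset)
  ultimately show ?thesis by (metis card_image)
qed

lemma finite_leaves: "finite (leaves t)"
  by (induction t) (auto simp: leaves_CNode)

lemma leaves_nonempty: "is_cotree t \<Longrightarrow> leaves t \<noteq> {}"
proof (induction t)
  case (CNode b ts)
  then have "0 < length ts" by auto
  then have "ts ! 0 \<in> set ts" by simp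
  then have "leaves (ts ! 0) \<noteq> {}" using CNode by simp
  then show ?case using \<open>0 < length ts\<close> by (auto simp: leaves_CNode)
qed simp

lemma card_leaves_CNode: "card (leaves (CNode b ts)) = sum_list (map (\<lambda>t. card (leaves t)) ts)"
proof -
  have "card (leaves (CNode b ts)) = (\<Sum>i<length ts. card ((#) i ` leaves (ts ! i)))"
    unfolding leaves_CNode by (rule card_UN_disjoint) (auto simp: finite_leaves)
  also have "\<dots> = (\<Sum>i<length ts. card (leaves (ts ! i)))"
    by (simp add: card_image)
  finally show ?thesis by (simp add: sum_list_sum_nth atLeast0LessThan)
qed

lemma card_leaves_cotree_of: "valid t \<Longrightarrow> card (leaves (cotree_of b t)) = num_leaves t"
proof (induction t arbitrary: b)
  case (Node p ts)
  then have "map (\<lambda>t. card (leaves (cotree_of (\<not> b) t))) ts = map num_leaves ts" if "ts \<noteq> []"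
    using that by (auto simp: valid.simps)
  with Node.prems show ?case
    by (auto simp: valid.simps card_leaves_CNode o_def simp del: map_eq_conv)
qed

section \<open>Isomorphisms assembled from the children\<close>

lemma parent_of_simps [simp]:
  "\<not> parent_of p []" "parent_of [] (i # p) \<longleftrightarrow> p = []"
  "parent_of (i # p) (j # q) \<longleftrightarrow> i = j \<and> parent_of p q"
  by (auto simp: parent_of_def)

lemma cotree_iso_CNode:
  assumes \<pi>: "bij_betw \<pi> {..<length ts} {..<length us}"
    and iso: "\<And>i. i < length ts \<Longrightarrow> cotree_iso (ts ! i) (us ! \<pi> i)"
  shows "cotree_iso (CNode b ts) (CNode b us)"
proof -
  have "\<forall>i. \<exists>f. i < length ts \<longrightarrow> bij_betw f (nodes (ts ! i)) (nodes (us ! \<pi> i)) \<and> f [] = [] \<and>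
     (\<forall>p\<in>nodes (ts ! i). label_at (us ! \<pi> i) (f p) = label_at (ts ! i) p) \<and>
     (\<forall>p\<in>nodes (ts ! i). \<forall>q\<in>nodes (ts ! i). parent_of p q \<longleftrightarrow> parent_of (f p) (f q))"
    using iso unfolding cotree_iso_def by blast
  then obtain g where g: "\<And>i. i < length ts \<Longrightarrow> bij_betw (g i) (nodes (ts ! i)) (nodes (us ! \<pi> i))"
    "\<And>i. i < length ts \<Longrightarrow> g i [] = []"
    "\<And>i p. \<lbrakk>i < length ts; p \<in> nodes (ts ! i)\<rbrakk> \<Longrightarrow> label_at (us ! \<pi> i) (g i p) = label_at (ts ! i) p"
    "\<And>i p q. \<lbrakk>i < length ts; p \<in> nodes (ts ! i); q \<in> nodes (ts ! i)\<rbrakk>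
      \<Longrightarrow> parent_of p q \<longleftrightarrow> parent_of (g i p) (g i q)"
    unfolding choice_iff by blast
  have \<pi>_less: "\<pi> i < length us" if "i < length ts" for i
    using \<pi> that by (auto simp: bij_betw_def)
  have \<pi>_eq: "\<pi> i = \<pi> j \<longleftrightarrow> i = j" if "i < length ts" "j < length ts" for i j
    using \<pi> that by (auto simp: bij_betw_def inj_on_def)
  have g_eq: "g i p = g i q \<longleftrightarrow> p = q" if "i < length ts" "p \<in> nodes (ts ! i)" "q \<in> nodes (ts ! i)" for i p q
    using g(1)[OF that(1)] that by (auto simp: bij_betw_def inj_on_def)
  have g_in: "g i p \<in> nodes (us ! \<pi> i)" if "i < length ts" "p \<in> nodes (ts ! i)" for i p
    using g(1)[OF that(1)] that by (auto simp: bij_betw_def)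
  define f where "f p = (case p of [] \<Rightarrow> [] | i # q \<Rightarrow> \<pi> i # g i q)" for p
  have f: "f [] = []" "f (i # q) = \<pi> i # g i q" for i q by (simp_all add: f_def)
  have "bij_betw f (nodes (CNode b ts)) (nodes (CNode b us))"
  proof (rule bij_betw_imageI)
    show "inj_on f (nodes (CNode b ts))"
    proof (rule inj_onI)
      fix p q assume "p \<in> nodes (CNode b ts)" "q \<in> nodes (CNode b ts)" "f p = f q"
      then show "p = q" by (cases p; cases q) (auto simp: f \<pi>_eq g_eq)
    qed
    show "f ` nodes (CNode b ts) = nodes (CNode b us)"
    proof (intro equalityI subsetI)
      fix q assume "q \<in> f ` nodes (CNode b ts)"
      then obtain p where "p \<in> nodes (CNode b ts)" "q = f p" by blast
      then show "q \<in> nodes (CNode b us)" by (cases p) (auto simp: f \<pi>_less g_in)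
    next
      fix q assume q: "q \<in> nodes (CNode b us)"
      show "q \<in> f ` nodes (CNode b ts)"
      proof (cases q)
        case Nil
        then show ?thesis using f(1) by (metis Nil_in_nodes imageI)
      next
        case (Cons j r)
        then have "j \<in> {..<length us}" using q by simp
        then obtain i where i: "i < length ts" "j = \<pi> i" using \<pi> by (auto simp: bij_betw_def)
        then have "r \<in> g i ` nodes (ts ! i)" using q Cons g(1)[of i] by (auto simp: bij_betw_def)
        then obtain p where "p \<in> nodes (ts ! i)" "r = g i p" by blast
        then have "i # p \<in> nodes (CNode b ts)" "q = f (i # p)" using i Cons by (auto simp: f)
        then show ?thesis by blast
      qed
    qed
  qed
  moreover have "label_at (CNode b us) (f p) = label_at (CNode b ts) p" if "p \<in> nodes (CNode b ts)" for p
    using that by (cases p) (auto simp: f \<pi>_less g(3))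
  moreover have "parent_of p q \<longleftrightarrow> parent_of (f p) (f q)"
    if "p \<in> nodes (CNode b ts)" "q \<in> nodes (CNode b ts)" for p q
  proof -
    \<comment> \<open>The children of the root are the addresses of length one; they correspond
      because \<open>g i\<close> sends only the root of a child to a root.\<close>
    have "r = [] \<longleftrightarrow> g i r = []" if "i < length ts" "r \<in> nodes (ts ! i)" for i r
      using g_eq[OF that, of "[]"] g(2)[OF that(1)] by auto
    moreover have "\<not> parent_of (i # r) []" for i r by (auto simp: parent_of_def)
    ultimately show ?thesis
      using that by (cases p; cases q) (auto simp: f \<pi>_eq g(4))
  qed
  ultimately show ?thesis unfolding cotree_iso_def using f(1) by blast
qed

section \<open>Graphs represented by cotrees\<close>

text \<open>\<open>E\<close> stays fixed while \<open>V\<close> shrinks in the inductions, so no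
  induced subgraphs have to be formed. Nothing is claimed about \<open>E u u\<close>.\<close>

definition represents :: "cotree \<Rightarrow> 'v set \<Rightarrow> ('v \<Rightarrow> 'v \<Rightarrow> bool) \<Rightarrow> bool" where
  "represents t V E \<longleftrightarrow> (\<exists>f. bij_betw f V (leaves t) \<and> (\<forall>u\<in>V. \<forall>v\<in>V. u \<noteq> v \<longrightarrow>
     (E u v \<longleftrightarrow> label_at t (longest_common_prefix (f u) (f v)) = Some True)))"

text \<open>The function \<open>h\<close> assigns to a vertex the index of the tree that contains it as a leaf.\<close>

definition represents_forest ::
    "bool \<Rightarrow> cotree list \<Rightarrow> ('v \<Rightarrow> nat) \<Rightarrow> 'v set \<Rightarrow> ('v \<Rightarrow> 'v \<Rightarrow> bool) \<Rightarrow> bool" where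
  "represents_forest b ts h V E \<longleftrightarrow> (\<forall>v\<in>V. h v < length ts) \<and>
     (\<forall>i<length ts. represents (ts ! i) {v \<in> V. h v = i} E) \<and>
     (\<forall>u\<in>V. \<forall>v\<in>V. h u \<noteq> h v \<longrightarrow> E u v = b)"

lemma represents_CLeaf_iff: "represents CLeaf V E \<longleftrightarrow> (\<exists>v. V = {v})"
proof
  assume "represents CLeaf V E"
  then obtain f where f: "bij_betw f V {[] :: nat list}" by (auto simp: represents_def)
  then have "card V = 1" using bij_betw_same_card by fastforce
  then show "\<exists>v. V = {v}" by (metis card_1_singletonE)
next
  assume "\<exists>v. V = {v}"
  then obtain v where "V = {v}" ..
  then have "bij_betw (\<lambda>_. []) V (leaves CLeaf)" by (auto simp: bij_betw_def)
  then show "represents CLeaf V E" unfolding represents_def using \<open>V = {v}\<close> by blast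
qed

text \<open>The first index of a leaf address names the child. Two addresses that differ there have
  the root as longest common prefix, so its label decides adjacency.\<close>

lemma represents_CNode_imp_forest:
  assumes "represents (CNode b ts) V E"
  shows "\<exists>h. represents_forest b ts h V E"
proof -
  obtain f where f: "bij_betw f V (leaves (CNode b ts))"
    "\<And>u v. \<lbrakk>u \<in> V; v \<in> V; u \<noteq> v\<rbrakk> \<Longrightarrow>
      E u v \<longleftrightarrow> label_at (CNode b ts) (longest_common_prefix (f u) (f v)) = Some True"
    using assms unfolding represents_def by blast
  define h where "h v = hd (f v)" for v
  define g where "g v = tl (f v)" for v
  have f_eq: "f v = h v # g v" if "v \<in> V" for v
  proof -
    have "f v \<in> leaves (CNode b ts)" using f(1) that by (auto simp: bij_betw_def)
    then show ?thesis by (cases "f v") (auto simp: h_def g_def)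
  qed
  have f_in: "h v < length ts" "g v \<in> leaves (ts ! h v)" if "v \<in> V" for v
  proof -
    have "f v \<in> leaves (CNode b ts)" using f(1) that by (auto simp: bij_betw_def)
    then show "h v < length ts" "g v \<in> leaves (ts ! h v)" using f_eq[OF that] by auto
  qed
  have "represents (ts ! i) {v \<in> V. h v = i} E" if i: "i < length ts" for i
    unfolding represents_def
  proof (intro exI conjI ballI impI)
    show "bij_betw g {v \<in> V. h v = i} (leaves (ts ! i))"
    proof (rule bij_betw_imageI)
      show "inj_on g {v \<in> V. h v = i}"
        using f(1) f_eq by (auto simp: bij_betw_def inj_on_def)
      show "g ` {v \<in> V. h v = i} = leaves (ts ! i)"
      proof (intro equalityI subsetI)
        fix p assume "p \<in> leaves (ts ! i)"
        then have "i # p \<in> f ` V" using f(1) i by (simp add: bij_betw_def)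
        then obtain v where "v \<in> V" "f v = i # p" by force
        then show "p \<in> g ` {v \<in> V. h v = i}" by (force simp: h_def g_def)
      qed (use f_in in auto)
    qed
    fix u v assume "u \<in> {v \<in> V. h v = i}" "v \<in> {v \<in> V. h v = i}" "u \<noteq> v"
    then show "E u v \<longleftrightarrow> label_at (ts ! i) (longest_common_prefix (g u) (g v)) = Some True"
      using f(2)[of u v] f_eq[of u] f_eq[of v] i by simp
  qed
  moreover have "E u v = b" if "u \<in> V" "v \<in> V" "h u \<noteq> h v" for u v
    using f(2)[of u v] f_eq[of u] f_eq[of v] that by auto
  ultimately show ?thesis using f_in unfolding represents_forest_def by blast
qed

lemma represents_forest_imp_CNode:
  assumes "represents_forest b ts h V E"
  shows "represents (CNode b ts) V E"
proof -
  have h: "\<And>v. v \<in> V \<Longrightarrow> h v < length ts" "\<And>u v. \<lbrakk>u \<in> V; v \<in> V; h u \<noteq> h v\<rbrakk> \<Longrightarrow> E u v = b"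
    using assms by (auto simp: represents_forest_def)
  have "\<forall>i. \<exists>g. i < length ts \<longrightarrow> bij_betw g {v \<in> V. h v = i} (leaves (ts ! i)) \<and>
    (\<forall>u\<in>{v \<in> V. h v = i}. \<forall>v\<in>{v \<in> V. h v = i}. u \<noteq> v \<longrightarrow>
      (E u v \<longleftrightarrow> label_at (ts ! i) (longest_common_prefix (g u) (g v)) = Some True))"
    using assms unfolding represents_forest_def represents_def by blast
  then obtain g where g: "\<And>i. i < length ts \<Longrightarrow> bij_betw (g i) {v \<in> V. h v = i} (leaves (ts ! i))"
    "\<And>i u v. \<lbrakk>i < length ts; u \<in> V; h u = i; v \<in> V; h v = i; u \<noteq> v\<rbrakk> \<Longrightarrow>
      E u v \<longleftrightarrow> label_at (ts ! i) (longest_common_prefix (g i u) (g i v)) = Some True"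
    unfolding choice_iff by blast
  define f where "f v = h v # g (h v) v" for v
  have "bij_betw f V (leaves (CNode b ts))"
  proof (rule bij_betw_imageI)
    show "inj_on f V"
    proof (rule inj_onI)
      fix u v assume uv: "u \<in> V" "v \<in> V" "f u = f v"
      then have "inj_on (g (h u)) {v \<in> V. h v = h u}" using g(1) h(1) by (simp add: bij_betw_def)
      then show "u = v" using uv by (auto simp: f_def inj_on_def)
    qed
    show "f ` V = leaves (CNode b ts)"
    proof (intro equalityI subsetI)
      fix p assume "p \<in> f ` V"
      then obtain v where v: "v \<in> V" "p = f v" by blast
      then have "g (h v) v \<in> leaves (ts ! h v)" using g(1)[of "h v"] h(1) by (auto simp: bij_betw_def)
      then show "p \<in> leaves (CNode b ts)" using v h(1) by (simp add: f_def)
    next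
      fix p assume p: "p \<in> leaves (CNode b ts)"
      then obtain i q where i: "p = i # q" "i < length ts" "q \<in> leaves (ts ! i)"
        by (cases p) auto
      then have "q \<in> g i ` {v \<in> V. h v = i}" using g(1)[of i] by (simp add: bij_betw_def)
      then show "p \<in> f ` V" using i(1) by (auto simp: f_def)
    qed
  qed
  moreover have "E u v \<longleftrightarrow> label_at (CNode b ts) (longest_common_prefix (f u) (f v)) = Some True"
    if "u \<in> V" "v \<in> V" "u \<noteq> v" for u v
  proof (cases "h u = h v")
    case True
    show ?thesis
      unfolding g(2)[OF h(1)[OF that(1)] that(1) refl that(2) True[symmetric] that(3)]
      using h(1)[OF that(2)] by (simp add: f_def True)
  next
    case False
    then show ?thesis using h(2)[OF that(1,2)] by (simp add: f_def)
  qed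
  ultimately show ?thesis unfolding represents_def by blast
qed

lemma represents_card: "represents t V E \<Longrightarrow> card V = card (leaves t)"
  unfolding represents_def using bij_betw_same_card by blast

lemma represents_nonempty: "\<lbrakk>represents t V E; is_cotree t\<rbrakk> \<Longrightarrow> V \<noteq> {}"
  using leaves_nonempty by (auto simp: represents_def bij_betw_def)

lemma represents_forest_part_nonempty:
  assumes "represents_forest b ts h V E" "is_cotree (CNode b ts)" "i < length ts"
  shows "\<exists>v\<in>V. h v = i"
  using assms represents_nonempty[of "ts ! i" "{v \<in> V. h v = i}" E]
  by (auto simp: represents_forest_def)

text \<open>Reorders the children and at the same time exchanges each for a cotree that represents
  the same graphs.\<close>

lemma represents_forest_permute:
  assumes "represents_forest b ts h V E" "bij_betw \<pi> {..<length ts} {..<length us}"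
    and imp: "\<And>i V. \<lbrakk>i < length ts; represents (ts ! i) V E\<rbrakk> \<Longrightarrow> represents (us ! \<pi> i) V E"
  shows "represents_forest b us (\<pi> \<circ> h) V E"
  unfolding represents_forest_def
proof (intro conjI ballI allI impI)
  have h: "\<And>v. v \<in> V \<Longrightarrow> h v < length ts" "\<And>i. i < length ts \<Longrightarrow> represents (ts ! i) {v \<in> V. h v = i} E"
    using assms(1) by (auto simp: represents_forest_def)
  show "(\<pi> \<circ> h) v < length us" if "v \<in> V" for v
    using h(1)[OF that] assms(2) by (auto simp: bij_betw_def)
  fix j assume "j < length us"
  then have "j \<in> \<pi> ` {..<length ts}" using assms(2) by (simp add: bij_betw_def)
  then obtain i where i: "i < length ts" "j = \<pi> i" by blast
  have "{v \<in> V. (\<pi> \<circ> h) v = j} = {v \<in> V. h v = i}"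
    using h(1) i assms(2) by (auto simp: bij_betw_def inj_on_def)
  then show "represents (us ! j) {v \<in> V. (\<pi> \<circ> h) v = j} E"
    using imp[OF i(1) h(2)[OF i(1)]] i(2) by simp
next
  fix u v assume "u \<in> V" "v \<in> V" "(\<pi> \<circ> h) u \<noteq> (\<pi> \<circ> h) v"
  moreover from this have "h u \<noteq> h v" by auto
  ultimately show "E u v = b" using assms(1) by (simp add: represents_forest_def)
qed

text \<open>The children are ordered recursively and then sorted by \<open>encode\<close>. The
  represented graphs are carried through the same induction, so that any cotree of a graph leads
  directly to an output for it. A single leaf fits either label \<open>b\<close>.\<close>

lemma ex_ordered_tree:
  assumes "is_cotree t" "root_label t \<noteq> Some (\<not> b)"
  shows "\<exists>s. valid s \<and> cotree_iso t (cotree_of b s) \<and>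
    (\<forall>(V :: 'v set) E. represents t V E \<longrightarrow> represents (cotree_of b s) V E)"
  using assms
proof (induction t arbitrary: b)
  case CLeaf
  have "cotree_iso CLeaf CLeaf" unfolding cotree_iso_def by (rule exI[of _ id]) auto
  then show ?case by (intro exI[of _ leaf]) simp
next
  case (CNode c ts)
  have c: "c = b" using CNode.prems(2) by simp
  have "\<exists>s. valid s \<and> cotree_iso t (cotree_of (\<not> b) s) \<and>
      (\<forall>(V :: 'v set) E. represents t V E \<longrightarrow> represents (cotree_of (\<not> b) s) V E)" if "t \<in> set ts" for t
    using CNode.IH[OF that, of "\<not> b"] CNode.prems(1) that c by auto
  then obtain g where g: "\<And>t. t \<in> set ts \<Longrightarrow> valid (g t)"
    "\<And>t. t \<in> set ts \<Longrightarrow> cotree_iso t (cotree_of (\<not> b) (g t))"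
    "\<And>t (V :: 'v set) E. \<lbrakk>t \<in> set ts; represents t V E\<rbrakk> \<Longrightarrow> represents (cotree_of (\<not> b) (g t)) V E"
    by metis
  define ss where "ss = sort_key encode (map g ts)"
  define s where "s = Node (sum_list (map num_leaves ss)) ss"
  have len: "length ss = length ts" "2 \<le> length ts" using CNode.prems(1) by (auto simp: ss_def)
  then have ss: "ss \<noteq> []" by auto
  have "valid s" using g(1) len ss by (auto simp: s_def valid.simps ss_def)
  have eq: "cotree_of b s = CNode b (map (cotree_of (\<not> b)) ss)" using ss by (simp add: s_def)
  obtain \<pi> where \<pi>: "bij_betw \<pi> {..<length ts} {..<length ss}" "\<And>i. i < length ts \<Longrightarrow> g (ts ! i) = ss ! \<pi> i"
    using permutation_Ex_bij[of "map g ts" ss] by (auto simp: ss_def)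
  have \<pi>': "\<pi> i < length ss" if "i < length ts" for i using \<pi>(1) that by (auto simp: bij_betw_def)
  have "cotree_iso (CNode c ts) (cotree_of b s)"
    unfolding eq c using \<pi> \<pi>' g(2) by (intro cotree_iso_CNode[of \<pi>]) (auto simp flip: \<pi>(2))
  moreover have "represents (cotree_of b s) V E" if rep: "represents (CNode c ts) V E" for V :: "'v set" and E
  proof -
    obtain h where "represents_forest b ts h V E" using represents_CNode_imp_forest rep c by blast
    then have "represents_forest b (map (cotree_of (\<not> b)) ss) (\<pi> \<circ> h) V E"
      using \<pi> \<pi>' g(3) by (elim represents_forest_permute) (auto simp flip: \<pi>(2))
    then show ?thesis unfolding eq by (rule represents_forest_imp_CNode)
  qed
  ultimately show ?case using \<open>valid s\<close> by blast
qed

text \<open>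
  The parts of the vertex set below the root with label \<open>b\<close> are the components of the relation
  \<open>E u v \<noteq> b\<close>. They have diameter at most 2 because the labels alternate.
\<close>

lemma same_part_iff:
  assumes "represents_forest b ts h V E" "is_cotree (CNode b ts)" "u \<in> V" "v \<in> V"
  shows "h u = h v \<longleftrightarrow> u = v \<or> E u v \<noteq> b \<or> (\<exists>w\<in>V. E u w \<noteq> b \<and> E w v \<noteq> b)"
proof
  assume eq: "h u = h v"
  define i where "i = h u"
  define W where "W = {v \<in> V. h v = i}"
  have i: "i < length ts" "represents (ts ! i) W E"
    using assms(1,3) by (auto simp: represents_forest_def i_def W_def)
  then have child: "is_cotree (ts ! i)" "root_label (ts ! i) \<noteq> Some b" using assms(2) by auto
  have uv: "u \<in> W" "v \<in> W" using assms eq by (auto simp: W_def i_def)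
  show "u = v \<or> E u v \<noteq> b \<or> (\<exists>w\<in>V. E u w \<noteq> b \<and> E w v \<noteq> b)"
  proof (cases "ts ! i")
    case CLeaf
    then show ?thesis using i(2) uv by (auto simp: represents_CLeaf_iff)
  next
    case (CNode c us)
    then have c: "c \<noteq> b" "2 \<le> length us" using child by auto
    obtain k where k: "represents_forest c us k W E"
      using represents_CNode_imp_forest i(2) CNode by metis
    have "0 < length us" "1 < length us" using c(2) by auto
    \<comment> \<open>If \<open>u\<close> and \<open>v\<close> lie below the same grandchild of the
      root, a vertex below another one has the status \<open>c\<close> to both and serves as the
      middle vertex.\<close>
    then obtain j where j: "j < length us" "j \<noteq> k u"
      using that[of 0] that[of 1] by (cases "k u = 0") auto
    obtain w where w: "w \<in> W" "k w = j"
      using represents_forest_part_nonempty[OF k] child(1) CNode j(1) by auto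
    have cross: "E x y = c" if "x \<in> W" "y \<in> W" "k x \<noteq> k y" for x y
      using k that by (simp add: represents_forest_def)
    show ?thesis
    proof (cases "k u = k v")
      case True
      then have "E u w \<noteq> b" "E w v \<noteq> b" using cross[of u w] cross[of w v] w j uv c(1) by auto
      then show ?thesis using w(1) by (auto simp: W_def)
    qed (use cross[of u v] uv c(1) in auto)
  qed
next
  assume R: "u = v \<or> E u v \<noteq> b \<or> (\<exists>w\<in>V. E u w \<noteq> b \<and> E w v \<noteq> b)"
  have "E x y = b" if "x \<in> V" "y \<in> V" "h x \<noteq> h y" for x y
    using assms(1) that by (simp add: represents_forest_def)
  then show "h u = h v" using R assms(3,4) by metis
qed

text \<open>Vertices \<open>u\<close> and \<open>v\<close> below different \<open>b\<close>-children
  have status \<open>b\<close> to each other, and no \<open>w\<close> has the opposite status to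
  both. With root label \<open>c\<close> opposite to \<open>b\<close> they would lie in one part,
  and any \<open>w\<close> outside it would have status \<open>c\<close> to both.\<close>

lemma represents_label_unique:
  assumes "represents (CNode b ts) V E" "is_cotree (CNode b ts)"
    and "represents (CNode c us) V E" "is_cotree (CNode c us)"
  shows "b = c"
proof (rule ccontr)
  assume "b \<noteq> c"
  obtain h k where h: "represents_forest b ts h V E" and k: "represents_forest c us k V E"
    using assms represents_CNode_imp_forest by metis
  have len: "0 < length ts" "1 < length ts" "0 < length us" "1 < length us" using assms by auto
  obtain u v where uv: "u \<in> V" "v \<in> V" "h u = 0" "h v = 1"
    using represents_forest_part_nonempty[OF h assms(2)] len by metis
  then have "h u \<noteq> h v" by simp
  then have not_R: "u \<noteq> v" "E u v = b" "\<And>w. w \<in> V \<Longrightarrow> E u w = b \<or> E w v = b"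
    using same_part_iff[OF h assms(2) uv(1,2)] by auto
  then have same: "k u = k v" using k uv \<open>b \<noteq> c\<close> by (auto simp: represents_forest_def)
  obtain w where w: "w \<in> V" "k w \<noteq> k u"
    using represents_forest_part_nonempty[OF k assms(4)] len(3,4) by (metis zero_neq_one)
  then have "E u w = c" "E w v = c" using k uv same by (auto simp: represents_forest_def)
  then show False using not_R(3)[OF w(1)] \<open>b \<noteq> c\<close> by auto
qed

section \<open>Uniqueness of the ordered tree of a graph\<close>

lemma mset_eq_if_bij_nth:
  assumes "bij_betw \<pi> {..<length xs} {..<length ys}" "\<And>i. i < length xs \<Longrightarrow> xs ! i = ys ! \<pi> i"
  shows "mset xs = mset ys"
proof -
  have mset_nth: "mset zs = image_mset ((!) zs) (mset_set {..<length zs})" for zs :: "'a list"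
    by (metis atLeast0LessThan map_nth mset_map mset_upt)
  have "mset xs = image_mset (\<lambda>i. ys ! \<pi> i) (mset_set {..<length xs})"
    unfolding mset_nth[of xs] using assms(2) by (intro image_mset_cong) auto
  also have "\<dots> = image_mset ((!) ys) (mset_set {..<length ys})"
  proof -
    have "mset_set {..<length ys} = image_mset \<pi> (mset_set {..<length xs})"
      using assms(1) by (metis bij_betw_def image_mset_mset_set)
    then show ?thesis by (simp add: multiset.map_comp o_def)
  qed
  finally show ?thesis using mset_nth by metis
qed

lemma valid_forest_eqI:
  assumes "valid_forest ts" "valid_forest ss" "mset ts = mset ss"
  shows "ts = ss"
proof -
  have "map encode ts = map encode ss"
    using assms by (metis mset_map properties_for_sort valid_forest_def)
  moreover have "inj_on encode (set ts \<union> set ss)"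
    using assms encode_inject by (auto simp: inj_on_def valid_forest_def)
  ultimately show ?thesis by (metis map_inj_on)
qed

text \<open>Both roots split \<open>V\<close> in the same way, which matches the children by a
  bijection \<open>\<pi>\<close>. Matched children represent the same vertex set under the opposite
  label, so they agree by induction, and sorted lists with equal multisets coincide.\<close>

lemma represents_unique:
  assumes "valid t" "valid s" "represents (cotree_of b t) V E" "represents (cotree_of b s) V E"
  shows "t = s"
  using assms
proof (induction t arbitrary: b s V)
  case (Node p ts)
  have card: "card V = p" "card V = num_leaves s"
    using represents_card[OF Node.prems(3)] represents_card[OF Node.prems(4)]
      card_leaves_cotree_of[OF Node.prems(1)] card_leaves_cotree_of[OF Node.prems(2)]
    by (simp_all del: cotree_of_Node)
  obtain ss where s: "s = Node p ss" using card by (cases s) auto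
  show ?case
  proof (cases "p = 1")
    case True
    then have "Node p ts \<in> trees 1" "s \<in> trees 1" using Node.prems(1,2) s by (auto simp: trees_def)
    then show ?thesis unfolding trees_1 by simp
  next
    case False
    then have v: "valid_forest ts" "valid_forest ss" "ts \<noteq> []" "ss \<noteq> []"
      using Node.prems(1,2) s by (auto simp: valid_Node_iff proper_partitions_def)
    define us where "us = map (cotree_of (\<not> b)) ts"
    define ws where "ws = map (cotree_of (\<not> b)) ss"
    have eq: "cotree_of b (Node p ts) = CNode b us" "cotree_of b s = CNode b ws"
      using v s by (auto simp: us_def ws_def)
    then have cot: "is_cotree (CNode b us)" "is_cotree (CNode b ws)"
      using Node.prems is_cotree_cotree_of by metis+
    obtain h k where h: "represents_forest b us h V E" and k: "represents_forest b ws k V E"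
      using represents_CNode_imp_forest Node.prems eq by metis
    \<comment> \<open>The characterization of the parts mentions only \<open>V\<close>,
      \<open>E\<close> and \<open>b\<close>, not the cotree.\<close>
    have kernel: "h x = h y \<longleftrightarrow> k x = k y" if "x \<in> V" "y \<in> V" for x y
      using same_part_iff[OF h cot(1) that] same_part_iff[OF k cot(2) that] by simp
    obtain x where x: "\<And>i. i < length ts \<Longrightarrow> x i \<in> V \<and> h (x i) = i"
      using represents_forest_part_nonempty[OF h cot(1)] by (metis length_map us_def)
    define \<pi> where "\<pi> i = k (x i)" for i
    have \<pi>_h: "k y = \<pi> (h y)" if "y \<in> V" for y
    proof -
      have "h y < length ts" using h that by (auto simp: represents_forest_def us_def)
      then show ?thesis using x[of "h y"] kernel[OF that, of "x (h y)"] by (simp add: \<pi>_def)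
    qed
    have "bij_betw \<pi> {..<length ts} {..<length ss}"
    proof (rule bij_betw_imageI)
      show "inj_on \<pi> {..<length ts}"
      proof (rule inj_onI)
        fix i j assume "i \<in> {..<length ts}" "j \<in> {..<length ts}" "\<pi> i = \<pi> j"
        then show "i = j" using x[of i] x[of j] kernel[of "x i" "x j"] by (simp add: \<pi>_def)
      qed
      show "\<pi> ` {..<length ts} = {..<length ss}"
      proof (intro equalityI subsetI)
        fix j assume "j \<in> \<pi> ` {..<length ts}"
        then show "j \<in> {..<length ss}"
          using x k by (auto simp: \<pi>_def represents_forest_def ws_def)
      next
        fix j assume "j \<in> {..<length ss}"
        then obtain y where y: "y \<in> V" "k y = j"
          using represents_forest_part_nonempty[OF k cot(2), of j] by (auto simp: ws_def)
        then show "j \<in> \<pi> ` {..<length ts}"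
          using \<pi>_h[of y] h by (auto simp: represents_forest_def us_def)
      qed
    qed
    moreover have "ts ! i = ss ! \<pi> i" if i: "i < length ts" for i
    proof -
      have \<pi>i: "\<pi> i < length ss" using calculation i by (auto simp: bij_betw_def)
      have "h y = i \<longleftrightarrow> k y = \<pi> i" if "y \<in> V" for y
        using kernel[OF that, of "x i"] x[OF i] by (simp add: \<pi>_def)
      then have "{y \<in> V. h y = i} = {y \<in> V. k y = \<pi> i}" by blast
      then have "represents (cotree_of (\<not> b) (ss ! \<pi> i)) {y \<in> V. h y = i} E"
        using k \<pi>i by (auto simp: represents_forest_def ws_def)
      moreover have "represents (cotree_of (\<not> b) (ts ! i)) {y \<in> V. h y = i} E"
        using h i by (auto simp: represents_forest_def us_def)
      ultimately show ?thesis
        using Node.IH[of "ts ! i" "ss ! \<pi> i"] v(1,2) i \<pi>i by (auto simp: valid_forest_def)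
    qed
    ultimately have "mset ts = mset ss"
      by (intro mset_eq_if_bij_nth) auto
    then show ?thesis using valid_forest_eqI v(1,2) s by blast
  qed
qed

section \<open>Cographs\<close>

text \<open>Stated for a set and a relation, to match \<open>represents\<close> and to pass to
  subsets of \<open>V\<close> with the same \<open>E\<close>.\<close>

definition p4_free :: "'v set \<Rightarrow> ('v \<Rightarrow> 'v \<Rightarrow> bool) \<Rightarrow> bool" where
  "p4_free V E \<longleftrightarrow> \<not> (\<exists>a\<in>V. \<exists>b\<in>V. \<exists>c\<in>V. \<exists>d\<in>V. distinct [a, b, c, d] \<and>
     E a b \<and> E b c \<and> E c d \<and> \<not> E a c \<and> \<not> E a d \<and> \<not> E b d)"

lemma p4_freeD:
  "\<lbrakk>p4_free V E; a \<in> V; b \<in> V; c \<in> V; d \<in> V; distinct [a, b, c, d];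
    E a b; E b c; E c d; \<not> E a c; \<not> E a d; \<not> E b d\<rbrakk> \<Longrightarrow> False"
  unfolding p4_free_def by blast

lemma p4_free_subset: "\<lbrakk>p4_free V E; W \<subseteq> V\<rbrakk> \<Longrightarrow> p4_free W E"
  unfolding p4_free_def by blast

definition adj :: "'v graph \<Rightarrow> 'v \<Rightarrow> 'v \<Rightarrow> bool" where
  "adj G u v \<longleftrightarrow> {u, v} \<in> snd G"

lemma adj_sym: "adj G u v = adj G v u"
  by (simp add: adj_def insert_commute)

lemma not_adj_self: "simple_graph G \<Longrightarrow> \<not> adj G u u"
  by (auto simp: simple_graph_def adj_def)

lemma not_P4_subgraph_if_p4_free:
  assumes "p4_free (fst G) (adj G)" "W \<subseteq> fst G"
  shows "\<not> graph_iso (induced_subgraph G W) P4"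
proof
  assume "graph_iso (induced_subgraph G W) P4"
  then obtain f where f: "bij_betw f W {0, 1, 2, 3 :: nat}"
    "\<And>u v. \<lbrakk>u \<in> W; v \<in> W\<rbrakk> \<Longrightarrow> adj G u v \<longleftrightarrow> {f u, f v} \<in> snd P4"
    by (auto simp: graph_iso_def induced_subgraph_def P4_def adj_def)
  have "f ` W = {0, 1, 2, 3}" using f(1) by (simp add: bij_betw_def)
  then have "0 \<in> f ` W" "1 \<in> f ` W" "2 \<in> f ` W" "3 \<in> f ` W" by simp_all
  then obtain a b c d where in_W: "a \<in> W" "b \<in> W" "c \<in> W" "d \<in> W"
    and vals: "f a = 0" "f b = 1" "f c = 2" "f d = 3"
    unfolding image_iff by metis
  have "distinct [a, b, c, d]" using vals by auto
  moreover have "adj G a b" "adj G b c" "adj G c d" "\<not> adj G a c" "\<not> adj G a d" "\<not> adj G b d"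
    using f(2) in_W by (auto simp: vals P4_def doubleton_eq_iff)
  ultimately show False
    using p4_freeD[OF assms(1), of a b c d] in_W assms(2) by blast
qed

lemma cograph_imp_p4_free:
  assumes "cograph G"
  shows "p4_free (fst G) (adj G)"
  unfolding p4_free_def
proof (intro notI, elim bexE conjE)
  fix a b c d
  assume in_V: "a \<in> fst G" "b \<in> fst G" "c \<in> fst G" "d \<in> fst G" and dist: "distinct [a, b, c, d]"
    and E: "adj G a b" "adj G b c" "adj G c d" "\<not> adj G a c" "\<not> adj G a d" "\<not> adj G b d"
  have "simple_graph G" using assms by (simp add: cograph_def)
  define W where "W = {a, b, c, d}"
  define f :: "'a \<Rightarrow> nat" where "f x = (if x = a then 0 else if x = b then 1 else if x = c then 2 else 3)" for x
  have vals: "f a = 0" "f b = 1" "f c = 2" "f d = 3" using dist by (auto simp: f_def)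
  have "bij_betw f W {0, 1, 2, 3}"
    using dist by (auto simp: W_def bij_betw_def inj_on_def vals)
  moreover have "adj G u v \<longleftrightarrow> {f u, f v} \<in> snd P4" if "u \<in> W" "v \<in> W" for u v
  proof -
    \<comment> \<open>Both sides are symmetric, so it suffices to check the pairs in path order;
      equal vertices are covered by the absence of loops.\<close>
    have "adj G x y \<longleftrightarrow> {f x, f y} \<in> snd P4" if "x \<in> W" "y \<in> W" "f x \<le> f y" for x y
      using that E not_adj_self[OF \<open>simple_graph G\<close>]
      unfolding W_def by (elim insertE emptyE) (auto simp: vals P4_def doubleton_eq_iff)
    then show ?thesis
      using that adj_sym[of G u v] by (metis insert_commute nle_le)
  qed
  ultimately have "graph_iso (induced_subgraph G W) P4"
    by (auto simp: graph_iso_def induced_subgraph_def P4_def adj_def intro!: exI[of _ f])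
  then show False using assms in_V by (auto simp: cograph_def W_def)
qed

text \<open>The path on four vertices and its complement are both connected, so under either root
  label its vertices lie below a single child.\<close>

lemma represents_imp_p4_free:
  assumes "represents t V E"
  shows "p4_free V E"
  using assms
proof (induction t arbitrary: V)
  case CLeaf
  then show ?case by (auto simp: represents_CLeaf_iff p4_free_def)
next
  case (CNode l ts)
  obtain h where h: "represents_forest l ts h V E"
    using represents_CNode_imp_forest[OF CNode.prems] by blast
  then have cross: "h u = h v" if "u \<in> V" "v \<in> V" "E u v \<noteq> l" for u v
    using that by (auto simp: represents_forest_def)
  show ?case
    unfolding p4_free_def
  proof (intro notI, elim bexE conjE)
    fix a b c d
    assume in_V: "a \<in> V" "b \<in> V" "c \<in> V" "d \<in> V" and dist: "distinct [a, b, c, d]"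
      and E: "E a b" "E b c" "E c d" "\<not> E a c" "\<not> E a d" "\<not> E b d"
    define W where "W = {v \<in> V. h v = h a}"
    have "h b = h a" "h c = h a" "h d = h a"
      using cross in_V E by (cases l; metis)+
    then have "a \<in> W" "b \<in> W" "c \<in> W" "d \<in> W" using in_V by (auto simp: W_def)
    moreover have "p4_free W E"
      using h in_V(1) CNode.IH[of "ts ! h a" W] by (auto simp: represents_forest_def W_def)
    ultimately show False using p4_freeD[of W E a b c d] dist E by blast
  qed
qed

text \<open>
  A cut of the vertices other than \<open>x\<close> extends to one that includes \<open>x\<close>: if the edges of a cut
  \<open>A, B\<close> all have the status \<open>b\<close>, and neither moving \<open>x\<close> to one side nor splitting off the vertices of \<open>A\<close>
  that have status \<open>b\<close> with \<open>x\<close> gives a cut, then there is an induced path through \<open>x\<close>.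
\<close>

lemma p4_free_homogeneous_cut:
  assumes "finite V" "2 \<le> card V" "p4_free V E" "\<And>u v. E u v = E v u"
  shows "\<exists>A B b. A \<noteq> {} \<and> B \<noteq> {} \<and> A \<inter> B = {} \<and> A \<union> B = V \<and> (\<forall>u\<in>A. \<forall>v\<in>B. E u v = b)"
  using assms(1-3)
proof (induction V rule: finite_induct)
  case (insert x V)
  show ?case
  proof (cases "2 \<le> card V")
    case False
    then have "card V = 1" using insert by simp
    then obtain y where "V = {y}" by (metis card_1_singletonE)
    then show ?thesis using insert.hyps
      by (intro exI[of _ "{x}"] exI[of _ "{y}"] exI[of _ "E x y"]) auto
  next
    case True
    then obtain A0 B0 b where cut0: "A0 \<noteq> {}" "B0 \<noteq> {}" "A0 \<inter> B0 = {}" "A0 \<union> B0 = V"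
      "\<forall>u\<in>A0. \<forall>v\<in>B0. E u v = b"
      using insert.IH p4_free_subset[OF insert.prems(2), of V] by blast
    show ?thesis
    proof (cases "\<forall>y\<in>V. E x y \<noteq> b")
      case True
      then show ?thesis using insert.hyps cut0
        by (intro exI[of _ "{x}"] exI[of _ V] exI[of _ "\<not> b"]) auto
    next
      case False
      then obtain y where y: "y \<in> V" "E x y = b" by blast
      \<comment> \<open>The cut is turned so that \<open>y\<close> lies in \<open>A\<close>; this
        makes \<open>D\<close> nonempty.\<close>
      obtain A B where cut: "B \<noteq> {}" "A \<inter> B = {}" "A \<union> B = V" "y \<in> A"
        "\<And>u v. \<lbrakk>u \<in> A; v \<in> B\<rbrakk> \<Longrightarrow> E u v = b"
      proof (cases "y \<in> A0")
        case True
        then show ?thesis using that[of B0 A0] cut0 by blast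
      next
        case False
        then have "y \<in> B0" using y(1) cut0(4) by blast
        moreover have "E u v = b" if "u \<in> B0" "v \<in> A0" for u v
          using cut0(5) that assms(4) by blast
        ultimately show ?thesis using that[of A0 B0] cut0 by blast
      qed
      \<comment> \<open>Splitting off \<open>D\<close> can fail only inside \<open>A\<close>: the
        pairs with \<open>B\<close> have status \<open>b\<close> by the cut, those with
        \<open>x\<close> by definition.\<close>
      define D where "D = {v \<in> A. E x v = b}"
      show ?thesis
      proof (cases "\<forall>u\<in>D. \<forall>w\<in>A - D. E u w = b")
        case True
        have "\<forall>u\<in>D. \<forall>v\<in>insert x V - D. E u v = b"
          using True cut(3,5) assms(4) by (auto simp: D_def)
        moreover have "y \<in> D" "x \<notin> D" "D \<subseteq> V" using cut y insert.hyps by (auto simp: D_def)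
        ultimately show ?thesis
          by (intro exI[of _ D] exI[of _ "insert x V - D"] exI[of _ b]) blast
      next
        case False
        then obtain u w where uw: "u \<in> A" "E x u = b" "w \<in> A" "E x w \<noteq> b" "E u w \<noteq> b"
          by (auto simp: D_def)
        show ?thesis
        proof (cases "\<forall>a\<in>B. E x a = b")
          case True
          have "\<forall>u\<in>B. \<forall>v\<in>insert x A. E u v = b" using True cut(5) assms(4) by blast
          moreover have "x \<notin> B" using cut(3) insert.hyps by blast
          ultimately show ?thesis using cut(1-3)
            by (intro exI[of _ B] exI[of _ "insert x A"] exI[of _ b]) blast
        next
          case False
          then obtain a where a: "a \<in> B" "E x a \<noteq> b" by blast
          have ab: "E u a = b" "E w a = b" using cut(5) uw a by auto
          have dist: "distinct [u, w, x, a]"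
            using uw a cut(2,3) insert.hyps(2) by auto
          have in_V: "u \<in> insert x V" "w \<in> insert x V" "x \<in> insert x V" "a \<in> insert x V"
            using uw a cut(3) by auto
          \<comment> \<open>If \<open>b\<close> holds, \<open>w, a, u, x\<close> is an induced path.
            Otherwise edges and non-edges are exchanged, and \<open>u, w, x, a\<close> is
            one.\<close>
          have False
          proof (cases b)
            case True
            show False
              using p4_freeD[OF insert.prems(2) in_V(2,4,1,3)] dist uw a ab True assms(4) by auto
          next
            case b: False
            show False
              using p4_freeD[OF insert.prems(2) in_V] dist uw a ab b assms(4) by auto
          qed
          then show ?thesis ..
        qed
      qed
    qed
  qed
qed simp

section \<open>Existence of cotrees\<close>

lemma represents_forest_append:
  assumes "represents_forest b ts h A E" "represents_forest b ss k B E" "A \<inter> B = {}"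
    and "\<And>u v. \<lbrakk>u \<in> A; v \<in> B\<rbrakk> \<Longrightarrow> E u v = b" "\<And>u v. \<lbrakk>u \<in> B; v \<in> A\<rbrakk> \<Longrightarrow> E u v = b"
  shows "represents_forest b (ts @ ss) (\<lambda>v. if v \<in> A then h v else length ts + k v) (A \<union> B) E"
    (is "represents_forest _ _ ?g _ _")
  unfolding represents_forest_def
proof (intro conjI ballI allI impI)
  have h: "\<And>v. v \<in> A \<Longrightarrow> h v < length ts" and k: "\<And>v. v \<in> B \<Longrightarrow> k v < length ss"
    using assms(1,2) by (auto simp: represents_forest_def)
  show "?g v < length (ts @ ss)" if "v \<in> A \<union> B" for v
    using that h k by (auto simp: trans_less_add1)
  fix i assume i: "i < length (ts @ ss)"
  show "represents ((ts @ ss) ! i) {v \<in> A \<union> B. ?g v = i} E"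
  proof (cases "i < length ts")
    case True
    then have "{v \<in> A \<union> B. ?g v = i} = {v \<in> A. h v = i}" by auto
    then show ?thesis using True assms(1) by (simp add: represents_forest_def nth_append)
  next
    case False
    then have "{v \<in> A \<union> B. ?g v = i} = {v \<in> B. k v = i - length ts}"
      using assms(3) h by fastforce
    then show ?thesis using False i assms(2) by (simp add: represents_forest_def nth_append)
  qed
next
  fix u v assume "u \<in> A \<union> B" "v \<in> A \<union> B" "?g u \<noteq> ?g v"
  then show "E u v = b"
    using assms unfolding represents_forest_def by (auto split: if_splits)
qed

text \<open>To be placed below a new root with label \<open>b\<close>, a cotree whose root already
  has this label is dissolved into its children; otherwise labels would not alternate.\<close>

lemma ex_forest_of_cotree:
  assumes "is_cotree t" "represents t V E"
  shows "\<exists>ts h. ts \<noteq> [] \<and> (\<forall>t\<in>set ts. is_cotree t \<and> root_label t \<noteq> Some b) \<and> represents_forest b ts h V E"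
proof (cases "root_label t = Some b")
  case True
  then obtain ts where t: "t = CNode b ts" by (cases t) auto
  then obtain h where "represents_forest b ts h V E"
    using assms(2) represents_CNode_imp_forest by blast
  moreover have "ts \<noteq> []" "\<forall>t\<in>set ts. is_cotree t \<and> root_label t \<noteq> Some b"
    using assms(1) t by auto
  ultimately show ?thesis by blast
next
  case False
  have "represents_forest b [t] (\<lambda>_. 0) V E" using assms(2) by (simp add: represents_forest_def)
  then show ?thesis using assms(1) False by (intro exI[of _ "[t]"]) auto
qed

lemma p4_free_imp_ex_cotree:
  assumes "finite V" "V \<noteq> {}" "p4_free V E" "\<And>u v. E u v = E v u"
  shows "\<exists>t. is_cotree t \<and> represents t V E"
  using assms(1-3)
proof (induction V rule: finite_psubset_induct)
  case (psubset V)
  show ?case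
  proof (cases "card V = 1")
    case True
    then have "represents CLeaf V E" unfolding represents_CLeaf_iff by (metis card_1_singletonE)
    then show ?thesis by (intro exI[of _ CLeaf]) simp
  next
    case False
    then have "2 \<le> card V" using psubset by (metis One_nat_def Suc_1 Suc_leI card_gt_0_iff le_neq_implies_less)
    then obtain A B b where cut: "A \<noteq> {}" "B \<noteq> {}" "A \<inter> B = {}" "A \<union> B = V" "\<forall>u\<in>A. \<forall>v\<in>B. E u v = b"
      using p4_free_homogeneous_cut[of V E] psubset assms(4) by metis
    then have "A \<subset> V" "B \<subset> V" by auto
    then obtain t s where t: "is_cotree t" "represents t A E" and s: "is_cotree s" "represents s B E"
      using psubset cut p4_free_subset by (metis psubset_imp_subset)
    obtain ts h where ts: "ts \<noteq> []" "\<forall>t\<in>set ts. is_cotree t \<and> root_label t \<noteq> Some b"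
      "represents_forest b ts h A E"
      using ex_forest_of_cotree[OF t, of b] by blast
    obtain ss k where ss: "ss \<noteq> []" "\<forall>t\<in>set ss. is_cotree t \<and> root_label t \<noteq> Some b"
      "represents_forest b ss k B E"
      using ex_forest_of_cotree[OF s, of b] by blast
    have "represents (CNode b (ts @ ss)) V E"
      unfolding cut(4)[symmetric]
      using represents_forest_append[OF ts(3) ss(3) cut(3)] cut(5) assms(4)
      by (intro represents_forest_imp_CNode) blast
    moreover have "is_cotree (CNode b (ts @ ss))"
      using ts ss by (cases ts; cases ss) auto
    ultimately show ?thesis by blast
  qed
qed

section \<open>The graph of a cotree\<close>

lemma longest_common_prefix_commute: "longest_common_prefix p q = longest_common_prefix q p"
proof (induction p arbitrary: q)
  case Nil
  then show ?case by (cases q) auto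
next
  case (Cons i p)
  then show ?case by (cases q) auto
qed

lemma adj_cotree_graph_iff:
  "adj (cotree_graph t) p q \<longleftrightarrow> p \<in> leaves t \<and> q \<in> leaves t \<and> p \<noteq> q \<and>
     label_at t (longest_common_prefix p q) = Some True"
  by (auto simp: adj_def cotree_graph_def doubleton_eq_iff longest_common_prefix_commute)

lemma simple_cotree_graph: "simple_graph (cotree_graph t)"
  by (auto simp: simple_graph_def cotree_graph_def finite_leaves)

lemma fst_cotree_graph [simp]: "fst (cotree_graph t) = leaves t"
  by (simp add: cotree_graph_def)

text \<open>Links the relational view to isomorphism of graphs; the pairs with \<open>u = v\<close>
  agree because neither graph has loops.\<close>

lemma graph_iso_cotree_graph_iff:
  assumes "simple_graph G"
  shows "graph_iso G (cotree_graph t) \<longleftrightarrow> represents t (fst G) (adj G)"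
proof -
  have "(\<forall>u\<in>fst G. \<forall>v\<in>fst G. adj G u v \<longleftrightarrow> adj (cotree_graph t) (f u) (f v)) \<longleftrightarrow>
    (\<forall>u\<in>fst G. \<forall>v\<in>fst G. u \<noteq> v \<longrightarrow>
      (adj G u v \<longleftrightarrow> label_at t (longest_common_prefix (f u) (f v)) = Some True))"
    if "bij_betw f (fst G) (leaves t)" for f
  proof -
    have "f u \<in> leaves t" if "u \<in> fst G" for u
      using that \<open>bij_betw f (fst G) (leaves t)\<close> by (auto simp: bij_betw_def)
    moreover have "f u = f v \<longleftrightarrow> u = v" if "u \<in> fst G" "v \<in> fst G" for u v
      using that \<open>bij_betw f (fst G) (leaves t)\<close> by (auto simp: bij_betw_def inj_on_def)
    ultimately show ?thesis
      using not_adj_self[OF assms] by (metis adj_cotree_graph_iff)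
  qed
  moreover have "graph_iso G (cotree_graph t) \<longleftrightarrow> (\<exists>f. bij_betw f (fst G) (leaves t) \<and>
      (\<forall>u\<in>fst G. \<forall>v\<in>fst G. adj G u v \<longleftrightarrow> adj (cotree_graph t) (f u) (f v)))"
    by (simp add: graph_iso_def adj_def)
  ultimately show ?thesis unfolding represents_def by blast
qed

lemma represents_cotree_graph: "represents t (leaves t) (adj (cotree_graph t))"
proof -
  have "graph_iso (cotree_graph t) (cotree_graph t)"
    unfolding graph_iso_def by (rule exI[of _ id]) auto
  then show ?thesis by (simp add: graph_iso_cotree_graph_iff simple_cotree_graph)
qed

lemma cograph_cotree_graph: "cograph (cotree_graph t)"
  unfolding cograph_def
  using simple_cotree_graph not_P4_subgraph_if_p4_free[of "cotree_graph t"]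
    represents_imp_p4_free[OF represents_cotree_graph[of t]] by auto

text \<open>From two leaves on the root is an inner node, so its label is visible in the graph. Once
  the labels agree, uniqueness of the ordered tree applies.\<close>

lemma cotree_of_eq_if_graph_iso:
  assumes "t \<in> trees n" "s \<in> trees n" "2 \<le> n"
    and iso: "graph_iso (cotree_graph (cotree_of b t)) (cotree_graph (cotree_of c s))"
  shows "b = c \<and> t = s"
proof -
  let ?V = "leaves (cotree_of b t)" and ?E = "adj (cotree_graph (cotree_of b t))"
  have v: "valid t" "valid s" using assms by (auto simp: trees_def)
  have rep: "represents (cotree_of b t) ?V ?E" "represents (cotree_of c s) ?V ?E"
    using represents_cotree_graph iso by (auto simp: graph_iso_cotree_graph_iff simple_cotree_graph)
  obtain ts where ts: "t = Node n ts" "map num_leaves ts \<in> proper_partitions n"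
    using assms(1,3) by (rule trees_casesE)
  obtain ss where ss: "s = Node n ss" "map num_leaves ss \<in> proper_partitions n"
    using assms(2,3) by (rule trees_casesE)
  have ne: "ts \<noteq> []" "ss \<noteq> []" using ts(2) ss(2) by (auto simp: proper_partitions_def)
  have "b = c"
    using represents_label_unique[of b _ ?V ?E c] rep
      is_cotree_cotree_of[OF v(1), of b] is_cotree_cotree_of[OF v(2), of c]
    unfolding ts(1) ss(1) using ne by auto
  then show ?thesis using represents_unique[OF v] rep by blast
qed

section \<open>The outputs of the run\<close>

lemma ex_output_of_tree:
  assumes "2 \<le> n" "t \<in> trees n"
  shows "\<exists>k s. nth_output n k = Some (cotree_of b t, s)"
proof -
  obtain i where "gen_tree n i = Some t" using gen_tree_surj[OF assms] by blast
  then obtain r where "generation n i = (Some t, r)" by (metis gen_tree_def prod.collapse)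
  \<comment> \<open>The parity of the output index is the root label, and half of the index counts
    the trees.\<close>
  then have "\<exists>s. nth_output n (2 * i + of_bool b) = Some (cotree_of b t, s)"
    by (simp add: nth_output_Some_iff)
  then show ?thesis by blast
qed

lemma nth_output_tree:
  assumes "nth_output n k = Some (c, s)" "2 \<le> n"
  obtains t where "gen_tree n (k div 2) = Some t" "t \<in> trees n" "c = cotree_of (odd k) t"
  using assms gen_tree_in_trees by (metis fst_conv gen_tree_def nth_output_Some_iff)

lemma ex_output_of_cotree:
  assumes "2 \<le> n" "is_cotree t" "card (leaves t) = n"
  shows "\<exists>k c s. nth_output n k = Some (c, s) \<and> cotree_iso t c \<and>
    (\<forall>(V :: 'v set) E. represents t V E \<longrightarrow> represents c V E)"
proof -
  obtain b where "root_label t \<noteq> Some (\<not> b)" by (metis option.inject)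
  then obtain s where s: "valid s" "cotree_iso t (cotree_of b s)"
    "\<forall>(V :: 'v set) E. represents t V E \<longrightarrow> represents (cotree_of b s) V E"
    using ex_ordered_tree[OF assms(2), of b] by metis
  then have "s \<in> trees n"
    using assms(3) cotree_iso_card_leaves card_leaves_cotree_of by (fastforce simp: trees_def)
  then show ?thesis using ex_output_of_tree[OF assms(1)] s by metis
qed

lemma ex_output_of_cograph:
  assumes "2 \<le> n" "cograph G" "card (fst G) = n"
  shows "\<exists>k c s. nth_output n k = Some (c, s) \<and> graph_iso G (cotree_graph c)"
proof -
  have G: "simple_graph G" using assms(2) by (simp add: cograph_def)
  have "finite (fst G)" "fst G \<noteq> {}" using G assms by (auto simp: simple_graph_def)
  then obtain t where t: "is_cotree t" "represents t (fst G) (adj G)"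
    using p4_free_imp_ex_cotree[OF _ _ cograph_imp_p4_free[OF assms(2)] adj_sym] by blast
  then have "card (leaves t) = n" using represents_card assms(3) by metis
  then show ?thesis
    using ex_output_of_cotree[OF assms(1) t(1)] t(2) graph_iso_cotree_graph_iff[OF G] by metis
qed

lemma outputs_distinct:
  assumes "2 \<le> n" "nth_output n j = Some (c, s)" "nth_output n k = Some (d, s')"
    and iso: "graph_iso (cotree_graph c) (cotree_graph d)"
  shows "j = k"
proof -
  obtain t where t: "gen_tree n (j div 2) = Some t" "t \<in> trees n" "c = cotree_of (odd j) t"
    using assms(2,1) by (rule nth_output_tree)
  obtain u where u: "gen_tree n (k div 2) = Some u" "u \<in> trees n" "d = cotree_of (odd k) u"
    using assms(3,1) by (rule nth_output_tree)
  have "odd j = odd k" "t = u"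
    using cotree_of_eq_if_graph_iso[OF t(2) u(2) assms(1)] iso t(3) u(3) by blast+
  moreover from this have "j div 2 = k div 2" using gen_tree_inject[OF assms(1)] t(1) u(1) by blast
  ultimately show ?thesis by (metis div_mult_mod_eq odd_iff_mod_2_eq_one even_iff_mod_2_eq_zero)
qed

theorem theorem3:
  "(\<forall>n\<ge>2.
      \<comment> \<open>(a)\<close>
      (\<forall>k c s. nth_output n k = Some (c, s) \<longrightarrow> is_cotree c \<and> card (leaves c) = n) \<and>
      (\<forall>t. is_cotree t \<and> card (leaves t) = n \<longrightarrow>
         (\<exists>k c s. nth_output n k = Some (c, s) \<and> cotree_iso t c)) \<and>
      \<comment> \<open>(b)\<close>
      (\<forall>k c s. nth_output n k = Some (c, s) \<longrightarrow> cograph (cotree_graph c)) \<and>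
      (\<forall>G :: 'v graph. cograph G \<and> card (fst G) = n \<longrightarrow>
         (\<exists>k c s. nth_output n k = Some (c, s) \<and> graph_iso G (cotree_graph c))) \<and>
      (\<forall>j k c d s s'. j \<noteq> k \<and> nth_output n j = Some (c, s) \<and> nth_output n k = Some (d, s') \<longrightarrow>
         \<not> graph_iso (cotree_graph c) (cotree_graph d))) \<and>
   \<comment> \<open>(c)\<close>
   (\<exists>C :: nat. \<forall>n\<ge>2. \<forall>k c d s s'.
      nth_output n k = Some (c, s) \<and> nth_output n (Suc k) = Some (d, s') \<longrightarrow> s' \<le> s + C * n) \<and>
   \<comment> \<open>(d)\<close>
   (\<exists>C :: nat. \<forall>n\<ge>2. \<exists>c s. nth_output n 0 = Some (c, s) \<and> s \<le> C * n)"
proof (intro conjI allI impI)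
  fix n k :: nat and c s
  assume "nth_output n k = Some (c, s)" "2 \<le> n"
  then obtain t where "t \<in> trees n" "c = cotree_of (odd k) t" by (rule nth_output_tree)
  then show "is_cotree c" "card (leaves c) = n"
    by (auto simp: trees_def is_cotree_cotree_of card_leaves_cotree_of)
next
  fix n t assume "2 \<le> n" "is_cotree t \<and> card (leaves t) = n"
  then show "\<exists>k c s. nth_output n k = Some (c, s) \<and> cotree_iso t c"
    using ex_output_of_cotree by blast
next
  fix n k :: nat and c and s :: nat
  show "cograph (cotree_graph c)" by (rule cograph_cotree_graph)
next
  fix n and G :: "'v graph" assume "2 \<le> n" "cograph G \<and> card (fst G) = n"
  then show "\<exists>k c s. nth_output n k = Some (c, s) \<and> graph_iso G (cotree_graph c)"
    using ex_output_of_cograph by blast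
next
  fix n j k c d s s'
  assume "2 \<le> n" "j \<noteq> k \<and> nth_output n j = Some (c, s) \<and> nth_output n k = Some (d, s')"
  then show "\<not> graph_iso (cotree_graph c) (cotree_graph d)" using outputs_distinct by blast
next
  show "\<exists>C :: nat. \<forall>n\<ge>2. \<forall>k c d s s'.
      nth_output n k = Some (c, s) \<and> nth_output n (Suc k) = Some (d, s') \<longrightarrow> s' \<le> s + C * n"
    using delay_linear by blast
next
  show "\<exists>C :: nat. \<forall>n\<ge>2. \<exists>c s. nth_output n 0 = Some (c, s) \<and> s \<le> C * n"
    using first_output_linear by blast
qed

end
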